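(* Let $(\mathcal G_1,e_1)$, $(\mathcal G_2,e_2)$ be rooted graphs with spectral distributions $\mu_1,\mu_2$, let their s-free loop product $\mathcal G_1*_{s,\ell}\mathcal G_2$ (with root $e=e_1$) be naturally colored, and let $A(\mathcal G_1*_{s,\ell}\mathcal G_2)=R_1+R_2$ be the decomposition of its adjacency matrix induced by the coloring. Put $Z=R_2R_1$. Then for every $n\in\mathbb N$ $$N_Z(n)=N_{\mu_1\boxtimes_s\mu_2}(n)=|D_{2n}(e)|,$$ where $N_Z(n)$ refers to the state $\varphi_e$, $\boxtimes_s$ is the s-free multiplicative convolution, and $D_{2n}(e)$ is the set of rooted alternating d-walks of length $2n$ on $\mathcal G_1*_{s,\ell}\mathcal G_2$. Moreover, the pair $(R_1-1,R_2-1)$ is s-free independent with respect to $(\varphi_e,\psi)$, where $\psi$ is the state associated with any unit vector in $\ell^2(V_1\setminus\{e_1\})$ ($V_1\setminus\{e_1\}$ being regarded as the set of non-root vertices of the copy of $\mathcal G_1$ containing the root).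
   Context: Graphs are non-oriented, connected, uniformly locally finite (bounded degrees), with a root, possibly with loops and multiple edges. The adjacency matrix of $\mathcal G$ is the operator $A(\mathcal G)\delta(x)=\sum_{x'\sim x}n(x,x')\delta(x')$ on $\ell^2(V)$, $n(x,x')$ being the number of edges joining $x,x'$ (a loop at $x$ contributes $1$ to $n(x,x)$). The state associated with a unit vector $\zeta$ is $\langle\cdot\,\zeta,\zeta\rangle$; $\varphi_e$ is the state associated with $\delta(e)$; the spectral distribution of $(\mathcal G,e)$ is the distribution of $A(\mathcal G)$ in $\varphi_e$. s-free product $\mathcal G_1*_s\mathcal G_2$: the inductive limit of rooted graphs $\mathcal B_1(m)$ with root $e_1$, where $\mathcal B_1(0)=\mathcal G_1$, $\mathcal B_1(1)$ is obtained by attaching a copy of $\mathcal G_2$ by its root to every vertex of $\mathcal G_1$ but $e_1$, and for $m\ge2$, $\mathcal B_1(m)$ is obtained from $\mathcal B_1(m-1)$ by attaching by its root a copy of $\mathcal G_1$ ($m$ even) or of $\mathcal G_2$ ($m$ odd) to every vertex of $\mathcal B_1(m-1)$ not in $\mathcal B_1(m-2)$. Natural coloring: edges of each copy of $\mathcal G_\iota$ get color $\iota\in\{1,2\}$. s-free loop product $\mathcal G_1*_{s,\ell}\mathcal G_2$: obtained from the naturally colored s-free product by attaching one loop of color $2$ to the root $e_1$. $R_\iota$ is the adjacency matrix of the subgraph of edges of color $\iota$. A walk from $v_0$ to $v_n$ is a sequence $(v_0,\beta_1,v_1,\dots,\beta_n,v_n)$, $\beta_i$ an edge joining $v_{i-1}$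 and $v_i$; its length is $n$. An f-walk from $v$ to $v$ is a walk with $v_0=v_n=v$ and $v_i\neq v$ for $1\le i\le n-1$. A walk is alternating if the colors of its successive edges alternate. An alternating d-walk from $v$ to $v$ is an alternating walk beginning with an edge of color $1$ which is the concatenation $(u_1,u_2)$ of two f-walks from $v$ to $v$. Rooted means $v=e$. For a unital functional $\mu$ on $\mathbb C[X]$ ($\mu(1)=1$; compactly supported measures are identified with their moment functionals) put $\psi_\mu(z)=\sum_{n\ge1}\mu(X^n)z^n$, $\eta_\mu=\psi_\mu/(1+\psi_\mu)=\sum_{n\ge1}N_\mu(n)z^n$ (formal power series; $\eta_\mu$ determines $\mu$), $\rho_\mu(z)=\eta_\mu(z)/z$. For a random variable $Z$ and a state, $N_Z(n)=N_\mu(n)$ with $\mu$ the distribution of $Z$ in that state. Orthogonal multiplicative convolution: $\eta_{\mu_1\angle\mu_2}(z)=z\rho_{\mu_1}(\eta_{\mu_2}(z))$. Put $\mu_1\angle_1\mu_2=\mu_1\angle\mu_2$, $\mu_1\angle_n\mu_2=\mu_1\angle(\mu_2\angle_{n-1}\mu_1)$. The $m$-th moment of $\mu_1\angle_n\mu_2$ does not depend on $n\ge m$, and the s-free multiplicative convolution $\mu_1\boxtimes_s\mu_2$ is the limit (in moments) of $\mu_1\angle_n\mu_2$ as $n\to\infty$. s-freeness: let $\mathcal A_1$ be a unital subalgebra and $\mathcal A_2$ a non-unital subalgebra with internal unit $1_2$ ($1_2b=b=b1_2$ for $b\in\mathcal A_2$). $(\mathcal A_1,\mathcal A_2)$ is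 s-free w.r.t. $(\varphi,\psi)$ if $\psi(1_2)=1$ and (i) $\varphi(a_1\cdots a_n)=0$ whenever $a_j\in\mathcal A_{i_j}^0$, $i_1\ne\dots\ne i_n$; (ii) $\varphi(w_11_2w_2)=\varphi(w_1w_2)-\varphi(w_1)\varphi(w_2)$ for all $w_1,w_2\in{\rm alg}(\mathcal A_1,\mathcal A_2)$; here $\mathcal A_1^0=\mathcal A_1\cap\ker\varphi$, $\mathcal A_2^0=\mathcal A_2\cap\ker\psi$. A pair $(a,b)$ is s-free (s-free independent) if there is $1_2$ such that $({\rm alg}(1,a),{\rm alg}(1_2,b))$ is s-free. *)

theory Defs
  imports
    "HOL-Analysis.Infinite_Sum"
    "HOL-Library.Uprod"
    "HOL-Computational_Algebra.Polynomial"
    "HOL-Algebra.Module"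
begin

section \<open>Rooted multigraphs\<close>

text \<open>
  Non-oriented graphs, possibly with loops and multiple edges. Every edge has an unordered pair of
  endpoints; a loop at \<open>x\<close> is an edge with endpoints \<open>Upair x x\<close>.
\<close>

record ('v, 'e) mgraph =
  verts :: "'v set"
  edges :: "'e set"
  ends :: "'e \<Rightarrow> 'v uprod"

record ('v, 'e) cgraph = "('v, 'e) mgraph" +
  color :: "'e \<Rightarrow> nat"

definition joins :: "('v, 'e, 'z) mgraph_scheme \<Rightarrow> 'e \<Rightarrow> 'v \<Rightarrow> 'v \<Rightarrow> bool" where
  "joins G b x y \<longleftrightarrow> b \<in> edges G \<and> ends G b = Upair x y"

definition edge_count :: "('v, 'e, 'z) mgraph_scheme \<Rightarrow> 'v \<Rightarrow> 'v \<Rightarrow> nat" where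
  "edge_count G x y = card {b. joins G b x y}"

definition adjacent :: "('v, 'e, 'z) mgraph_scheme \<Rightarrow> 'v \<Rightarrow> 'v \<Rightarrow> bool" where
  "adjacent G x y \<longleftrightarrow> (\<exists>b. joins G b x y)"

text \<open>
  A walk \<open>(v\<^sub>0, \<beta>\<^sub>1, v\<^sub>1, \<dots>, \<beta>\<^sub>n, v\<^sub>n)\<close> is encoded by the list of its \<open>n + 1\<close> vertices and the list
  of its \<open>n\<close> edges.
\<close>

type_synonym ('v, 'e) walk = "'v list \<times> 'e list"

definition is_walk :: "('v, 'e, 'z) mgraph_scheme \<Rightarrow> ('v, 'e) walk \<Rightarrow> bool" where
  "is_walk G = (\<lambda>(vs, bs). length vs = Suc (length bs) \<and> set vs \<subseteq> verts G \<and>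
     (\<forall>i < length bs. joins G (bs ! i) (vs ! i) (vs ! Suc i)))"

definition walk_length :: "('v, 'e) walk \<Rightarrow> nat" where
  "walk_length w = length (snd w)"

definition walk_from_to :: "('v, 'e, 'z) mgraph_scheme \<Rightarrow> 'v \<Rightarrow> 'v \<Rightarrow> ('v, 'e) walk \<Rightarrow> bool" where
  "walk_from_to G x y w \<longleftrightarrow> is_walk G w \<and> hd (fst w) = x \<and> last (fst w) = y"

definition connected_graph :: "('v, 'e, 'z) mgraph_scheme \<Rightarrow> bool" where
  "connected_graph G \<longleftrightarrow> (\<forall>x\<in>verts G. \<forall>y\<in>verts G. \<exists>w. walk_from_to G x y w)"

definition uniformly_locally_finite :: "('v, 'e, 'z) mgraph_scheme \<Rightarrow> bool" where
  "uniformly_locally_finite G \<longleftrightarrow> (\<exists>d. \<forall>x\<in>verts G.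
     finite {b\<in>edges G. x \<in> set_uprod (ends G b)} \<and>
     card {b\<in>edges G. x \<in> set_uprod (ends G b)} \<le> d)"

definition rooted_graph :: "('v, 'e, 'z) mgraph_scheme \<Rightarrow> 'v \<Rightarrow> bool" where
  "rooted_graph G r \<longleftrightarrow> (\<forall>b\<in>edges G. set_uprod (ends G b) \<subseteq> verts G) \<and>
     connected_graph G \<and> uniformly_locally_finite G \<and> r \<in> verts G"


section \<open>Colored walks\<close>

definition walk_concat :: "('v, 'e) walk \<Rightarrow> ('v, 'e) walk \<Rightarrow> ('v, 'e) walk" where
  "walk_concat w w' = (fst w @ tl (fst w'), snd w @ snd w')"

definition f_walk :: "('v, 'e, 'z) mgraph_scheme \<Rightarrow> 'v \<Rightarrow> ('v, 'e) walk \<Rightarrow> bool" where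
  "f_walk G v w \<longleftrightarrow> walk_from_to G v v w \<and> walk_length w \<ge> 1 \<and>
     (\<forall>i. 1 \<le> i \<and> i < walk_length w \<longrightarrow> fst w ! i \<noteq> v)"

definition alternating :: "('v, 'e, 'z) cgraph_scheme \<Rightarrow> ('v, 'e) walk \<Rightarrow> bool" where
  "alternating G w \<longleftrightarrow> successively (\<noteq>) (map (color G) (snd w))"

definition alternating_d_walk :: "('v, 'e, 'z) cgraph_scheme \<Rightarrow> 'v \<Rightarrow> ('v, 'e) walk \<Rightarrow> bool" where
  "alternating_d_walk G v w \<longleftrightarrow> alternating G w \<and> snd w \<noteq> [] \<and> color G (hd (snd w)) = 1 \<and>
     (\<exists>w1 w2. f_walk G v w1 \<and> f_walk G v w2 \<and> w = walk_concat w1 w2)"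

definition D_walks :: "('v, 'e, 'z) cgraph_scheme \<Rightarrow> nat \<Rightarrow> 'v \<Rightarrow> ('v, 'e) walk set" where
  "D_walks G n v = {w. alternating_d_walk G v w \<and> walk_length w = n}"


section \<open>s-free product and s-free loop product\<close>

text \<open>
  The vertices of the s-free product are words in the non-root vertices of the two graphs, the
  newest letter first, and the root is the empty word. A copy of \<open>G\<close> attached at \<open>w\<close> by its root
  has the vertices \<open>w\<close> (the root) and \<open>i v # w\<close> (\<open>v\<close> not the root), where \<open>i\<close> is \<open>Inl\<close> or \<open>Inr\<close>.
  The edge \<open>b\<close> of that copy is named \<open>(w, i b)\<close>.
\<close>

definition glue :: "'v \<Rightarrow> ('v \<Rightarrow> 'x) \<Rightarrow> 'x list \<Rightarrow> 'v \<Rightarrow> 'x list" where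
  "glue r i w v = (if v = r then w else i v # w)"

definition sfree_ends :: "('a, 'c) mgraph \<Rightarrow> 'a \<Rightarrow> ('b, 'd) mgraph \<Rightarrow> 'b \<Rightarrow>
    ('a + 'b) list \<times> ('c + 'd) \<Rightarrow> ('a + 'b) list uprod" where
  "sfree_ends G1 e1 G2 e2 = (\<lambda>(w, b). case b of
       Inl b1 \<Rightarrow> map_uprod (glue e1 Inl w) (ends G1 b1)
     | Inr b2 \<Rightarrow> map_uprod (glue e2 Inr w) (ends G2 b2))"

text \<open>Attaching a copy of \<open>G\<close>, with root \<open>r\<close>, to every vertex of \<open>B\<close> lying in \<open>S\<close>.\<close>

definition attach :: "('v, 'e) mgraph \<Rightarrow> 'v \<Rightarrow> ('v \<Rightarrow> 'x) \<Rightarrow> ('e \<Rightarrow> 'y) \<Rightarrow> 'x list set \<Rightarrow>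
    ('x list, 'x list \<times> 'y) mgraph \<Rightarrow> ('x list, 'x list \<times> 'y) mgraph" where
  "attach G r i j S B = B\<lparr>
     verts := verts B \<union> (\<Union>w\<in>S. glue r i w ` verts G),
     edges := edges B \<union> (\<Union>w\<in>S. (\<lambda>b. (w, j b)) ` edges G)\<rparr>"

fun sfree_stage :: "('a, 'c) mgraph \<Rightarrow> 'a \<Rightarrow> ('b, 'd) mgraph \<Rightarrow> 'b \<Rightarrow> nat \<Rightarrow>
    (('a + 'b) list, ('a + 'b) list \<times> ('c + 'd)) mgraph" where
  "sfree_stage G1 e1 G2 e2 0 =
     \<lparr>verts = glue e1 Inl [] ` verts G1, edges = (\<lambda>b. ([], Inl b)) ` edges G1,
      ends = sfree_ends G1 e1 G2 e2\<rparr>"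
| "sfree_stage G1 e1 G2 e2 (Suc 0) =
     (let B = sfree_stage G1 e1 G2 e2 0 in attach G2 e2 Inr Inr (verts B - {[]}) B)"
| "sfree_stage G1 e1 G2 e2 (Suc (Suc m)) =
     (let B = sfree_stage G1 e1 G2 e2 (Suc m);
          N = verts B - verts (sfree_stage G1 e1 G2 e2 m)
      in if even m then attach G1 e1 Inl Inl N B else attach G2 e2 Inr Inr N B)"

text \<open>
  The stages increase and share the map \<open>ends\<close>, so that their inductive limit is their union.
\<close>

definition sfree_product :: "('a, 'c) mgraph \<Rightarrow> 'a \<Rightarrow> ('b, 'd) mgraph \<Rightarrow> 'b \<Rightarrow>
    (('a + 'b) list, ('a + 'b) list \<times> ('c + 'd)) cgraph" where
  "sfree_product G1 e1 G2 e2 =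
     \<lparr>verts = (\<Union>m. verts (sfree_stage G1 e1 G2 e2 m)),
      edges = (\<Union>m. edges (sfree_stage G1 e1 G2 e2 m)),
      ends = sfree_ends G1 e1 G2 e2,
      color = (\<lambda>(w, b). case b of Inl _ \<Rightarrow> 1 | Inr _ \<Rightarrow> 2)\<rparr>"

text \<open>The additional loop of color 2 at the root is the edge \<open>None\<close>.\<close>

definition sfree_loop_product :: "('a, 'c) mgraph \<Rightarrow> 'a \<Rightarrow> ('b, 'd) mgraph \<Rightarrow> 'b \<Rightarrow>
    (('a + 'b) list, (('a + 'b) list \<times> ('c + 'd)) option) cgraph" where
  "sfree_loop_product G1 e1 G2 e2 = (let P = sfree_product G1 e1 G2 e2 in
     \<lparr>verts = verts P,
      edges = insert None (Some ` edges P),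
      ends = case_option (Upair [] []) (ends P),
      color = case_option 2 (color P)\<rparr>)"

definition color_subgraph :: "('v, 'e) cgraph \<Rightarrow> nat \<Rightarrow> ('v, 'e) cgraph" where
  "color_subgraph G k = G\<lparr>edges := {b\<in>edges G. color G b = k}\<rparr>"


section \<open>Operators on the Hilbert space of a vertex set\<close>

text \<open>
  \<open>ell2 V\<close> consists of functions on the whole vertex type which vanish outside \<open>V\<close>; in particular
  \<open>ell2 W \<subseteq> ell2 V\<close> for \<open>W \<subseteq> V\<close>.
\<close>

definition ell2 :: "'v set \<Rightarrow> ('v \<Rightarrow> complex) set" where
  "ell2 V = {f. (\<forall>x. x \<notin> V \<longrightarrow> f x = 0) \<and> (\<lambda>x. (cmod (f x))\<^sup>2) summable_on V}"

definition ell2_inner :: "'v set \<Rightarrow> ('v \<Rightarrow> complex) \<Rightarrow> ('v \<Rightarrow> complex) \<Rightarrow> complex" where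
  "ell2_inner V f g = (\<Sum>\<^sub>\<infinity>x\<in>V. f x * cnj (g x))"

definition ell2_norm :: "'v set \<Rightarrow> ('v \<Rightarrow> complex) \<Rightarrow> real" where
  "ell2_norm V f = sqrt (\<Sum>\<^sub>\<infinity>x\<in>V. (cmod (f x))\<^sup>2)"

definition delta :: "'v \<Rightarrow> 'v \<Rightarrow> complex" where
  "delta x = (\<lambda>y. if y = x then 1 else 0)"

text \<open>
  An operator on \<open>ell2 V\<close> is represented by its extension by \<open>0\<close> to all functions, so that equality
  of representatives is equality of operators; the product of the algebra is composition.
\<close>

definition bounded_ops :: "'v set \<Rightarrow> (('v \<Rightarrow> complex) \<Rightarrow> ('v \<Rightarrow> complex)) set" where
  "bounded_ops V = {T.
     (\<forall>f. f \<notin> ell2 V \<longrightarrow> T f = (\<lambda>x. 0)) \<and>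
     (\<forall>f\<in>ell2 V. T f \<in> ell2 V) \<and>
     (\<forall>f\<in>ell2 V. \<forall>g\<in>ell2 V. T (\<lambda>x. f x + g x) = (\<lambda>x. T f x + T g x)) \<and>
     (\<forall>c. \<forall>f\<in>ell2 V. T (\<lambda>x. c * f x) = (\<lambda>x. c * T f x)) \<and>
     (\<exists>C. \<forall>f\<in>ell2 V. ell2_norm V (T f) \<le> C * ell2_norm V f)}"

definition op_algebra :: "'v set \<Rightarrow> (complex, ('v \<Rightarrow> complex) \<Rightarrow> ('v \<Rightarrow> complex)) module" where
  "op_algebra V =
     \<lparr>carrier = bounded_ops V,
      mult = (\<lambda>S T. S \<circ> T),
      one = (\<lambda>f. if f \<in> ell2 V then f else (\<lambda>x. 0)),
      zero = (\<lambda>f x. 0),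
      add = (\<lambda>S T f x. S f x + T f x),
      smult = (\<lambda>c T f x. c * T f x)\<rparr>"

definition vector_state ::
    "'v set \<Rightarrow> ('v \<Rightarrow> complex) \<Rightarrow> (('v \<Rightarrow> complex) \<Rightarrow> ('v \<Rightarrow> complex)) \<Rightarrow> complex" where
  "vector_state V \<zeta> T = ell2_inner V (T \<zeta>) \<zeta>"

definition adjacency_op ::
    "('v, 'e, 'z) mgraph_scheme \<Rightarrow> ('v \<Rightarrow> complex) \<Rightarrow> ('v \<Rightarrow> complex)" where
  "adjacency_op G f = (if f \<in> ell2 (verts G)
     then (\<lambda>y. if y \<in> verts G then \<Sum>x | adjacent G x y. of_nat (edge_count G x y) * f x else 0)
     else (\<lambda>y. 0))"


lemma delta_in_ell2:
  assumes "x \<in> V"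
  shows "delta x \<in> ell2 V"
proof -
  have "(\<lambda>y. (cmod (delta x y))\<^sup>2) summable_on {x}"
    by simp
  then have "(\<lambda>y. (cmod (delta x y))\<^sup>2) summable_on V"
    by (rule summable_on_cong_neutral[THEN iffD1, rotated -1]) (use assms in \<open>auto simp: delta_def\<close>)
  then show ?thesis
    using assms by (auto simp: ell2_def delta_def)
qed

lemma adjacency_op_delta:
  assumes "rooted_graph G r" and "x \<in> verts G"
  shows "adjacency_op G (delta x) =
    (\<lambda>y. \<Sum>x' | adjacent G x x'. of_nat (edge_count G x x') * delta x' y)"
proof
  fix y
  have sym: "adjacent G u v \<longleftrightarrow> adjacent G v u" for u v
    by (auto simp: adjacent_def joins_def)
  have sub: "u \<in> verts G \<and> v \<in> verts G" if "adjacent G u v" for u v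
    using that assms(1) by (force simp: adjacent_def joins_def rooted_graph_def)
  have fin: "finite {v. adjacent G u v}" if "u \<in> verts G" for u
  proof (rule finite_surj)
    show "finite {b\<in>edges G. u \<in> set_uprod (ends G b)}"
      using assms(1) that by (auto simp: rooted_graph_def uniformly_locally_finite_def)
    show "{v. adjacent G u v} \<subseteq> (\<lambda>b. THE v. ends G b = Upair u v) `
        {b\<in>edges G. u \<in> set_uprod (ends G b)}"
    proof
      fix v assume "v \<in> {v. adjacent G u v}"
      then obtain b where b: "b \<in> edges G" "ends G b = Upair u v"
        by (auto simp: adjacent_def joins_def)
      then have "(THE v. ends G b = Upair u v) = v"
        by (intro the_equality) auto
      with b show "v \<in> (\<lambda>b. THE v. ends G b = Upair u v) `
          {b\<in>edges G. u \<in> set_uprod (ends G b)}"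
        by (intro image_eqI[where x = b]) auto
    qed
  qed
  have 1: "(\<Sum>u | adjacent G u y. of_nat (edge_count G u y) * delta x u) =
      (if adjacent G x y then of_nat (edge_count G x y) else (0::complex))" if "y \<in> verts G"
  proof -
    have "(\<Sum>u | adjacent G u y. of_nat (edge_count G u y) * delta x u) =
        (\<Sum>u | adjacent G u y. if u = x then of_nat (edge_count G u y) else (0::complex))"
      by (intro sum.cong) (auto simp: delta_def)
    then show ?thesis
      using fin[OF that] by (simp add: sym[of _ y])
  qed
  have 2: "(\<Sum>x' | adjacent G x x'. of_nat (edge_count G x x') * delta x' y) =
      (if adjacent G x y then of_nat (edge_count G x y) else (0::complex))"
  proof -
    have "(\<Sum>x' | adjacent G x x'. of_nat (edge_count G x x') * delta x' y) =
        (\<Sum>x' | adjacent G x x'. if x' = y then of_nat (edge_count G x x') else (0::complex))"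
      by (intro sum.cong) (auto simp: delta_def)
    then show ?thesis
      using fin[OF assms(2)] by simp
  qed
  show "adjacency_op G (delta x) y =
      (\<Sum>x' | adjacent G x x'. of_nat (edge_count G x x') * delta x' y)"
    using delta_in_ell2[OF assms(2)] 1 2 sub by (auto simp: adjacency_op_def)
qed


section \<open>Distributions and multiplicative convolutions\<close>

definition unital_functional :: "(complex poly \<Rightarrow> complex) \<Rightarrow> bool" where
  "unital_functional \<mu> \<longleftrightarrow> (\<forall>p q. \<mu> (p + q) = \<mu> p + \<mu> q) \<and>
     (\<forall>c p. \<mu> ([:c:] * p) = c * \<mu> p) \<and> \<mu> 1 = 1"

definition functional_of_moments :: "(nat \<Rightarrow> complex) \<Rightarrow> complex poly \<Rightarrow> complex" where
  "functional_of_moments m p = (\<Sum>k\<le>degree p. coeff p k * m k)"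

definition distribution ::
    "(complex, 'm) module \<Rightarrow> ('m \<Rightarrow> complex) \<Rightarrow> 'm \<Rightarrow> complex poly \<Rightarrow> complex" where
  "distribution M \<phi> a = functional_of_moments (\<lambda>k. \<phi> (a [^]\<^bsub>M\<^esub> k))"

definition spectral_distribution ::
    "('v, 'e, 'z) mgraph_scheme \<Rightarrow> 'v \<Rightarrow> complex poly \<Rightarrow> complex" where
  "spectral_distribution G r =
     distribution (op_algebra (verts G)) (vector_state (verts G) (delta r)) (adjacency_op G)"

definition moment :: "(complex poly \<Rightarrow> complex) \<Rightarrow> nat \<Rightarrow> complex" where
  "moment \<mu> k = \<mu> ([:0, 1:] ^ k)"

definition psi_series :: "(complex poly \<Rightarrow> complex) \<Rightarrow> complex fps" where
  "psi_series \<mu> = Abs_fps (\<lambda>n. if n = 0 then 0 else moment \<mu> n)"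

definition eta_series :: "(complex poly \<Rightarrow> complex) \<Rightarrow> complex fps" where
  "eta_series \<mu> = psi_series \<mu> / (1 + psi_series \<mu>)"

definition rho_series :: "(complex poly \<Rightarrow> complex) \<Rightarrow> complex fps" where
  "rho_series \<mu> = eta_series \<mu> / fps_X"

definition N_coeff :: "(complex poly \<Rightarrow> complex) \<Rightarrow> nat \<Rightarrow> complex" where
  "N_coeff \<mu> n = fps_nth (eta_series \<mu>) n"

definition orth_conv :: "(complex poly \<Rightarrow> complex) \<Rightarrow> (complex poly \<Rightarrow> complex) \<Rightarrow>
    complex poly \<Rightarrow> complex" where
  "orth_conv \<mu>1 \<mu>2 = (THE \<mu>. unital_functional \<mu> \<and>
     eta_series \<mu> = fps_X * fps_compose (rho_series \<mu>1) (eta_series \<mu>2))"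

lemma functional_of_moments_cong_degree:
  assumes "degree p \<le> n"
  shows "functional_of_moments m p = (\<Sum>k\<le>n. coeff p k * m k)"
  unfolding functional_of_moments_def
  by (rule sum.mono_neutral_left) (use assms in \<open>auto simp: coeff_eq_0\<close>)

lemma moment_functional_of_moments: "moment (functional_of_moments m) k = m k"
proof -
  have "functional_of_moments m (monom 1 k) = (\<Sum>i\<le>k. coeff (monom 1 k) i * m i)"
    by (rule functional_of_moments_cong_degree) (simp add: degree_monom_le)
  also have "\<dots> = (\<Sum>i\<le>k. if k = i then m i else 0)"
    by (intro sum.cong) auto
  finally show ?thesis
    by (simp add: moment_def monom_altdef)
qed

lemma unital_functional_of_moments:
  assumes "m 0 = 1"
  shows "unital_functional (functional_of_moments m)"
proof -
  have "functional_of_moments m (p + q) =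
      functional_of_moments m p + functional_of_moments m q" for p q
    using functional_of_moments_cong_degree[of "p + q" "max (degree p) (degree q)" m]
      functional_of_moments_cong_degree[of p "max (degree p) (degree q)" m]
      functional_of_moments_cong_degree[of q "max (degree p) (degree q)" m]
    by (simp add: degree_add_le sum.distrib algebra_simps)
  moreover have "functional_of_moments m ([:c:] * p) = c * functional_of_moments m p" for c p
    using functional_of_moments_cong_degree[of "[:c:] * p" "degree p" m]
    by (simp add: functional_of_moments_def degree_smult_le sum_distrib_left algebra_simps)
  ultimately show ?thesis
    using assms by (simp add: unital_functional_def functional_of_moments_def)
qed

lemma unital_functional_eq_moments:
  assumes "unital_functional \<mu>"
  shows "\<mu> = functional_of_moments (moment \<mu>)"
proof
  fix p
  have add: "\<mu> (p + q) = \<mu> p + \<mu> q" and scal: "\<mu> ([:c:] * p) = c * \<mu> p" for p q c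
    using assms by (auto simp: unital_functional_def)
  have 0: "\<mu> 0 = 0"
    using scal[of 0 0] by simp
  have "\<mu> (sum f A) = (\<Sum>k\<in>A. \<mu> (f k))" if "finite A" for f and A :: "nat set"
    using that by (induction A rule: finite_induct) (auto simp: 0 add)
  then have "\<mu> (\<Sum>k\<le>degree p. [:coeff p k:] * [:0, 1:] ^ k) = functional_of_moments (moment \<mu>) p"
    by (simp add: functional_of_moments_def moment_def scal del: mult_pCons_left)
  moreover have "(\<Sum>k\<le>degree p. [:coeff p k:] * [:0, 1:] ^ k) = p"
    by (simp add: poly_as_sum_of_monoms monom_altdef[symmetric] smult_monom)
  ultimately show "\<mu> p = functional_of_moments (moment \<mu>) p"
    by simp
qed

text \<open>
  Every power series without constant term is the \<open>\<eta>\<close>-series of exactly one unital functional;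
  in particular the description in \<open>orth_conv\<close> is proper.
\<close>

lemma ex1_eta_series:
  assumes "fps_nth h 0 = 0"
  shows "\<exists>!\<mu>. unital_functional \<mu> \<and> eta_series \<mu> = h"
proof -
  have inv: "psi_series \<mu> = eta_series \<mu> / (1 - eta_series \<mu>)" for \<mu>
  proof -
    let ?p = "psi_series \<mu>"
    have u: "fps_nth (1 + ?p) 0 \<noteq> 0"
      by (simp add: psi_series_def)
    have e: "eta_series \<mu> = ?p * inverse (1 + ?p)"
      unfolding eta_series_def by (rule fps_divide_unit[OF u])
    have i: "(1 + ?p) * inverse (1 + ?p) = 1"
      using inverse_mult_eq_1'[OF u] .
    have "1 - eta_series \<mu> = inverse (1 + ?p)"
      using i by (simp add: e algebra_simps)
    moreover have "eta_series \<mu> / inverse (1 + ?p) = ?p"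
      using u by (simp add: e fps_divide_unit mult.assoc fps_inverse_idempotent i[unfolded mult.commute[of "1 + ?p"]])
    ultimately show ?thesis by simp
  qed
  define \<psi> where "\<psi> = h / (1 - h)"
  have u: "fps_nth (1 - h) 0 \<noteq> 0" using assms by simp
  have ps: "\<psi> = h * inverse (1 - h)" unfolding \<psi>_def by (rule fps_divide_unit[OF u])
  have i: "(1 - h) * inverse (1 - h) = 1" using inverse_mult_eq_1'[OF u] .
  have p0: "fps_nth \<psi> 0 = 0" by (simp add: ps assms)
  define \<mu> where "\<mu> = functional_of_moments (\<lambda>k. if k = 0 then 1 else fps_nth \<psi> k)"
  have un: "unital_functional \<mu>"
    unfolding \<mu>_def by (rule unital_functional_of_moments) simp
  have "psi_series \<mu> = \<psi>"
    by (rule fps_ext) (simp add: psi_series_def \<mu>_def moment_functional_of_moments p0)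
  moreover have "1 + \<psi> = inverse (1 - h)"
    using i by (simp add: ps algebra_simps)
  ultimately have "eta_series \<mu> = \<psi> / inverse (1 - h)"
    by (simp add: eta_series_def)
  also have "\<dots> = h"
    using u by (simp add: ps fps_divide_unit mult.assoc fps_inverse_idempotent i[unfolded mult.commute[of "1 - h"]])
  finally have eta: "eta_series \<mu> = h" .
  show ?thesis
  proof (rule ex1I)
    show "unital_functional \<mu> \<and> eta_series \<mu> = h" using un eta by simp
  next
    fix \<nu> assume \<nu>: "unital_functional \<nu> \<and> eta_series \<nu> = h"
    then have "psi_series \<nu> = psi_series \<mu>" using inv eta by metis
    then have "moment \<nu> k = moment \<mu> k" if "k \<noteq> 0" for k
      using that by (metis (mono_tags, lifting) fps_nth_Abs_fps psi_series_def)
    moreover have "moment \<nu> 0 = moment \<mu> 0"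
      using \<nu> un by (simp add: moment_def unital_functional_def)
    ultimately have "moment \<nu> = moment \<mu>" by (metis ext)
    then show "\<nu> = \<mu>"
      using unital_functional_eq_moments \<nu> un by metis
  qed
qed

lemma orth_conv:
  shows unital_functional_orth_conv: "unital_functional (orth_conv \<mu>1 \<mu>2)"
    and eta_series_orth_conv: "eta_series (orth_conv \<mu>1 \<mu>2) =
      fps_X * fps_compose (rho_series \<mu>1) (eta_series \<mu>2)"
  using theI'[OF ex1_eta_series[of "fps_X * fps_compose (rho_series \<mu>1) (eta_series \<mu>2)"]]
  unfolding orth_conv_def by auto

text \<open>The iterated convolution is defined for \<open>n \<ge> 1\<close> only.\<close>

fun orth_conv_iter :: "nat \<Rightarrow> (complex poly \<Rightarrow> complex) \<Rightarrow> (complex poly \<Rightarrow> complex) \<Rightarrow>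
    complex poly \<Rightarrow> complex" where
  "orth_conv_iter (Suc 0) \<mu>1 \<mu>2 = orth_conv \<mu>1 \<mu>2"
| "orth_conv_iter (Suc (Suc n)) \<mu>1 \<mu>2 = orth_conv \<mu>1 (orth_conv_iter (Suc n) \<mu>2 \<mu>1)"

definition sfree_conv :: "(complex poly \<Rightarrow> complex) \<Rightarrow> (complex poly \<Rightarrow> complex) \<Rightarrow>
    complex poly \<Rightarrow> complex" where
  "sfree_conv \<mu>1 \<mu>2 =
     functional_of_moments (\<lambda>k. lim (\<lambda>n. moment (orth_conv_iter n \<mu>1 \<mu>2) k))"


section \<open>s-freeness\<close>

text \<open>Subalgebras need not contain the unit of the ambient algebra.\<close>

definition subalg :: "(complex, 'm) module \<Rightarrow> 'm set \<Rightarrow> bool" where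
  "subalg M A \<longleftrightarrow> A \<subseteq> carrier M \<and> \<zero>\<^bsub>M\<^esub> \<in> A \<and>
     (\<forall>a\<in>A. \<forall>b\<in>A. a \<oplus>\<^bsub>M\<^esub> b \<in> A) \<and> (\<forall>a\<in>A. \<forall>b\<in>A. a \<otimes>\<^bsub>M\<^esub> b \<in> A) \<and>
     (\<forall>c. \<forall>a\<in>A. c \<odot>\<^bsub>M\<^esub> a \<in> A)"

definition alg :: "(complex, 'm) module \<Rightarrow> 'm set \<Rightarrow> 'm set" where
  "alg M S = subalg M hull S"

definition list_product :: "(complex, 'm) module \<Rightarrow> 'm list \<Rightarrow> 'm" where
  "list_product M as = foldr (\<otimes>\<^bsub>M\<^esub>) as \<one>\<^bsub>M\<^esub>"

definition s_free :: "(complex, 'm) module \<Rightarrow> ('m \<Rightarrow> complex) \<Rightarrow> ('m \<Rightarrow> complex) \<Rightarrow>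
    'm set \<Rightarrow> 'm set \<Rightarrow> 'm \<Rightarrow> bool" where
  "s_free M \<phi> \<psi> A1 A2 u \<longleftrightarrow>
     subalg M A1 \<and> \<one>\<^bsub>M\<^esub> \<in> A1 \<and>
     subalg M A2 \<and> u \<in> A2 \<and> (\<forall>b\<in>A2. u \<otimes>\<^bsub>M\<^esub> b = b \<and> b \<otimes>\<^bsub>M\<^esub> u = b) \<and>
     \<psi> u = 1 \<and>
     (\<forall>is as. as \<noteq> [] \<and> successively (\<noteq>) is \<and>
        list_all2 (\<lambda>i a. i = (1::nat) \<and> a \<in> A1 \<and> \<phi> a = 0 \<or> i = 2 \<and> a \<in> A2 \<and> \<psi> a = 0) is as \<longrightarrow>
        \<phi> (list_product M as) = 0) \<and>
     (\<forall>w1\<in>alg M (A1 \<union> A2). \<forall>w2\<in>alg M (A1 \<union> A2).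
        \<phi> (w1 \<otimes>\<^bsub>M\<^esub> u \<otimes>\<^bsub>M\<^esub> w2) = \<phi> (w1 \<otimes>\<^bsub>M\<^esub> w2) - \<phi> w1 * \<phi> w2)"

definition s_free_pair :: "(complex, 'm) module \<Rightarrow> ('m \<Rightarrow> complex) \<Rightarrow> ('m \<Rightarrow> complex) \<Rightarrow>
    'm \<Rightarrow> 'm \<Rightarrow> bool" where
  "s_free_pair M \<phi> \<psi> a b \<longleftrightarrow>
     (\<exists>u\<in>carrier M. s_free M \<phi> \<psi> (alg M {\<one>\<^bsub>M\<^esub>, a}) (alg M {u, b}) u)"

end

theory Submission
  imports Defs "HOL-Analysis.Convex"
begin

text \<open>
  The vertices of the product are alternating words, and each color class of edges is a disjoint union
  of copies of one factor (plus the loop at the root). To reach the root, an alternating walk has to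
  remove the letters of its starting word one at a time, and the excursions made on the way are f-walks
  into fresh branches. Hence, in the variable that marks edges of color 1, the generating function of the
  alternating f-walks from the root is the solution \<open>D\<^sub>1\<close> of \<open>D\<^sub>1 = z \<rho>\<^sub>1(D\<^sub>2)\<close>, \<open>D\<^sub>2 = z \<rho>\<^sub>2(D\<^sub>1)\<close>, which is
  also the limit of the iterated orthogonal convolutions. Instead of decomposing walks, the proof
  writes down the product-form series of all vertices and checks that they satisfy the one-step
  recursion; the same series give the resolvent of \<open>R\<^sub>2 R\<^sub>1\<close> applied to the delta function of the root.
  The internal unit in the s-freeness statement is the projection off the root. A centered element of
  either algebra moves vectors supported on words of one parity to words of the other parity, so that an
  alternating product of them never returns to the root.
\<close>

section \<open>Sums over neighbours\<close>

text \<open>The loop serves both halves of the theorem. No copy of the second graph contains the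
  root, so without the loop \<open>R2\<close> would annihilate the root coordinate; with it,
  \<open>R2\<close> preserves that coordinate. An f-walk back to the root is then closed by one loop
  step, the moment series of \<open>R2 R1\<close> becomes 1 / (1 - D1), and \<open>R2 - 1\<close>
  has no root coordinate and kills the delta function of the root. This is what makes the projection
  off the root an internal unit. Only edges of color 1 are marked because one application of
  \<open>R2 R1\<close> uses one edge of each color. Guessing the series and checking a recursion
  avoids a bijection between walks and nested tuples of excursions: the recursion fixes all
  coefficients by induction on the exponent, so that walk counts and operator powers are both
  compared with the same series.\<close>

definition incident :: "('v, 'e, 'z) mgraph_scheme \<Rightarrow> 'v \<Rightarrow> 'e set" where
  "incident G x = {b\<in>edges G. x \<in> set_uprod (ends G b)}"

definition opposite :: "('v, 'e, 'z) mgraph_scheme \<Rightarrow> 'v \<Rightarrow> 'e \<Rightarrow> 'v" where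
  "opposite G x b = (THE y. ends G b = Upair x y)"

text \<open>The sum runs over edges, not over neighbours: multiplicities need no coefficient, and a
  loop, being a single incident edge, contributes once, as the convention for
  \<open>edge_count\<close> demands.\<close>

definition nbr_sum :: "('v, 'e, 'z) mgraph_scheme \<Rightarrow> ('v \<Rightarrow> 'a::comm_monoid_add) \<Rightarrow> 'v \<Rightarrow> 'a" where
  "nbr_sum G g x = (\<Sum>b\<in>incident G x. g (opposite G x b))"

text \<open>This is \<open>rooted_graph\<close> without connectedness and root: the color classes of
  the product are disconnected in general, yet their adjacency operators have to be bounded.\<close>

definition bounded_degree :: "('v, 'e, 'z) mgraph_scheme \<Rightarrow> bool" where
  "bounded_degree G \<longleftrightarrow> (\<forall>b\<in>edges G. set_uprod (ends G b) \<subseteq> verts G) \<and> uniformly_locally_finite G"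

lemma opposite_eq: "ends G b = Upair x y \<Longrightarrow> opposite G x b = y"
  unfolding opposite_def by (rule the_equality) auto

lemma ends_opposite: "b \<in> incident G x \<Longrightarrow> ends G b = Upair x (opposite G x b)"
proof -
  assume "b \<in> incident G x"
  then obtain y where "ends G b = Upair x y"
    by (cases "ends G b") (auto simp: incident_def)
  then show ?thesis
    using opposite_eq[of G b x y] by metis
qed

lemma joins_iff: "joins G b x y \<longleftrightarrow> b \<in> incident G x \<and> opposite G x b = y"
proof
  assume "joins G b x y"
  then show "b \<in> incident G x \<and> opposite G x b = y"
    using opposite_eq[of G b x y] by (simp add: joins_def incident_def)
next
  assume "b \<in> incident G x \<and> opposite G x b = y"
  then show "joins G b x y"
    using ends_opposite[of b G x] by (simp add: joins_def incident_def)
qed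

lemma joins_sym: "joins G b x y \<longleftrightarrow> joins G b y x"
  by (auto simp: joins_def)

lemma joins_iff': "joins G b x y \<longleftrightarrow> b \<in> incident G y \<and> opposite G y b = x"
  using joins_iff joins_sym by metis

lemma incident_opposite:
  assumes "b \<in> incident G x"
  shows "b \<in> incident G (opposite G x b)" and "opposite G (opposite G x b) b = x"
proof -
  have "joins G b x (opposite G x b)"
    using assms by (simp add: joins_iff)
  then show "b \<in> incident G (opposite G x b)" and "opposite G (opposite G x b) b = x"
    by (simp_all add: joins_iff')
qed

lemma bounded_degree_opposite:
  "bounded_degree G \<Longrightarrow> b \<in> incident G x \<Longrightarrow> opposite G x b \<in> verts G"
  using incident_opposite(1)[of b G x] by (auto simp: bounded_degree_def incident_def)

lemma finite_incident:
  assumes "bounded_degree G"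
  shows "finite (incident G x)"
proof (cases "x \<in> verts G")
  case True
  then show ?thesis
    using assms by (auto simp: bounded_degree_def uniformly_locally_finite_def incident_def)
next
  case False
  then have "incident G x = {}"
    using assms by (auto simp: bounded_degree_def incident_def)
  then show ?thesis
    by simp
qed

lemma rooted_graph_bounded_degree: "rooted_graph G r \<Longrightarrow> bounded_degree G"
  by (auto simp: rooted_graph_def bounded_degree_def)

text \<open>Group the incident edges by their far endpoint: the fibre over a neighbour
  \<open>x\<close> has \<open>edge_count G x y\<close> elements.\<close>

lemma sum_adjacent_eq_nbr_sum:
  fixes f :: "'v \<Rightarrow> 'a::semiring_1"
  assumes "bounded_degree G"
  shows "(\<Sum>x | adjacent G x y. of_nat (edge_count G x y) * f x) = nbr_sum G f y"
proof -
  have adj: "{x. adjacent G x y} = opposite G y ` incident G y"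
    by (auto simp: adjacent_def joins_iff')
  have count: "edge_count G x y = card {b\<in>incident G y. opposite G y b = x}" for x
    by (simp add: edge_count_def joins_iff')
  have "nbr_sum G f y =
      (\<Sum>x\<in>opposite G y ` incident G y. \<Sum>b | b \<in> incident G y \<and> opposite G y b = x. f (opposite G y b))"
    unfolding nbr_sum_def by (rule sum.image_gen[OF finite_incident[OF assms]])
  also have "\<dots> = (\<Sum>x\<in>opposite G y ` incident G y. of_nat (edge_count G x y) * f x)"
    by (auto simp: count intro!: sum.cong)
  finally show ?thesis
    by (simp add: adj)
qed

lemma adjacency_op_eq:
  assumes "bounded_degree G" and "f \<in> ell2 (verts G)"
  shows "adjacency_op G f = (\<lambda>y. if y \<in> verts G then nbr_sum G f y else 0)"
  using assms by (simp add: adjacency_op_def sum_adjacent_eq_nbr_sum fun_eq_iff)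

lemma nbr_sum_cong:
  "(\<And>b. b \<in> incident G x \<Longrightarrow> f (opposite G x b) = g (opposite G x b)) \<Longrightarrow> nbr_sum G f x = nbr_sum G g x"
  by (simp add: nbr_sum_def)

lemma nbr_sum_mult_left:
  fixes c :: "'a::semiring_0"
  shows "nbr_sum G (\<lambda>y. c * g y) x = c * nbr_sum G g x"
  by (simp add: nbr_sum_def sum_distrib_left)

lemma nbr_sum_mult_right:
  fixes c :: "'a::semiring_0"
  shows "nbr_sum G (\<lambda>y. g y * c) x = nbr_sum G g x * c"
  by (simp add: nbr_sum_def sum_distrib_right)

lemma nbr_sum_add: "nbr_sum G (\<lambda>y. f y + g y) x = nbr_sum G f x + nbr_sum G g x"
  by (simp add: nbr_sum_def sum.distrib)

lemma fps_nth_nbr_sum: "fps_nth (nbr_sum G g x) n = nbr_sum G (\<lambda>y. fps_nth (g y) n) x"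
  by (simp add: nbr_sum_def fps_sum_nth)

section \<open>Bounded operators on the Hilbert space of a vertex set\<close>

lemma ell2_iff_summable_on_UNIV:
  "f \<in> ell2 V \<longleftrightarrow> (\<forall>x. x \<notin> V \<longrightarrow> f x = 0) \<and> (\<lambda>x. (cmod (f x))\<^sup>2) summable_on UNIV"
proof -
  have "(\<lambda>x. (cmod (f x))\<^sup>2) summable_on V \<longleftrightarrow> (\<lambda>x. (cmod (f x))\<^sup>2) summable_on UNIV"
    if "\<forall>x. x \<notin> V \<longrightarrow> f x = 0"
    using that by (intro summable_on_cong_neutral) auto
  then show ?thesis
    by (auto simp: ell2_def)
qed

lemma ell2_mono: "W \<subseteq> V \<Longrightarrow> f \<in> ell2 W \<Longrightarrow> f \<in> ell2 V"
  by (auto simp: ell2_iff_summable_on_UNIV)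

lemma ell2_zero: "(\<lambda>x. 0) \<in> ell2 V"
  by (simp add: ell2_def)

lemma ell2_mult: "f \<in> ell2 V \<Longrightarrow> (\<lambda>x. c * f x) \<in> ell2 V"
  by (auto simp: ell2_def norm_mult power_mult_distrib intro: summable_on_cmult_right)

text \<open>Estimates are made for squares, so no square root enters them;
  \<open>bounded_opsI\<close> and \<open>bounded_ops_norm_sq\<close> translate to
  \<open>ell2_norm\<close>.\<close>

definition norm_sq :: "'v set \<Rightarrow> ('v \<Rightarrow> complex) \<Rightarrow> real" where
  "norm_sq V f = (\<Sum>\<^sub>\<infinity>x\<in>V. (cmod (f x))\<^sup>2)"

lemma norm_sq_nonneg: "0 \<le> norm_sq V f"
  by (simp add: norm_sq_def infsum_nonneg)

lemma ell2_norm_eq: "ell2_norm V f = sqrt (norm_sq V f)"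
  by (simp add: ell2_norm_def norm_sq_def)

lemma ell2I_finite_sums:
  assumes "\<And>x. x \<notin> V \<Longrightarrow> f x = 0"
    and "\<And>F. finite F \<Longrightarrow> F \<subseteq> V \<Longrightarrow> (\<Sum>x\<in>F. (cmod (f x))\<^sup>2) \<le> C"
  shows "f \<in> ell2 V" and "norm_sq V f \<le> C"
proof -
  have s: "(\<lambda>x. (cmod (f x))\<^sup>2) summable_on V"
    by (rule nonneg_bdd_above_summable_on) (auto intro!: bdd_aboveI[where M = C] assms)
  then show "f \<in> ell2 V"
    using assms(1) by (simp add: ell2_def)
  show "norm_sq V f \<le> C"
    unfolding norm_sq_def by (rule infsum_le_finite_sums[OF s]) (rule assms)
qed

lemma sum_le_norm_sq:
  assumes "f \<in> ell2 V" and "finite F" and "F \<subseteq> V"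
  shows "(\<Sum>x\<in>F. (cmod (f x))\<^sup>2) \<le> norm_sq V f"
  using assms unfolding norm_sq_def by (intro finite_sum_le_infsum) (auto simp: ell2_def)

lemma cmod_add_sq_le: "(cmod (a + b))\<^sup>2 \<le> 2 * (cmod a)\<^sup>2 + 2 * (cmod b)\<^sup>2"
proof -
  have "(cmod (a + b))\<^sup>2 \<le> (cmod a + cmod b)\<^sup>2"
    by (intro power_mono norm_triangle_ineq) simp
  also have "\<dots> \<le> 2 * (cmod a)\<^sup>2 + 2 * (cmod b)\<^sup>2"
    using sum_squares_bound[of "cmod a" "cmod b"] by (simp add: power2_sum)
  finally show ?thesis .
qed

text \<open>Minkowski is replaced by the cruder \<open>cmod_add_sq_le\<close>, summed over finite
  sets; the factor 2 is harmless, since boundedness asks for some constant.\<close>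

lemma ell2_add:
  assumes "f \<in> ell2 V" and "g \<in> ell2 V"
  shows "(\<lambda>x. f x + g x) \<in> ell2 V"
    and "norm_sq V (\<lambda>x. f x + g x) \<le> 2 * norm_sq V f + 2 * norm_sq V g"
proof -
  have "(\<Sum>x\<in>F. (cmod (f x + g x))\<^sup>2) \<le> 2 * norm_sq V f + 2 * norm_sq V g"
    if "finite F" "F \<subseteq> V" for F
  proof -
    have "(\<Sum>x\<in>F. (cmod (f x + g x))\<^sup>2) \<le> (\<Sum>x\<in>F. 2 * (cmod (f x))\<^sup>2 + 2 * (cmod (g x))\<^sup>2)"
      by (intro sum_mono cmod_add_sq_le)
    also have "\<dots> = 2 * (\<Sum>x\<in>F. (cmod (f x))\<^sup>2) + 2 * (\<Sum>x\<in>F. (cmod (g x))\<^sup>2)"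
      by (simp add: sum.distrib sum_distrib_left)
    finally show ?thesis
      using sum_le_norm_sq[OF assms(1) that] sum_le_norm_sq[OF assms(2) that] by simp
  qed
  note * = ell2I_finite_sums[of V "\<lambda>x. f x + g x", OF _ this]
  show "(\<lambda>x. f x + g x) \<in> ell2 V"
    using assms by (intro *(1)) (auto simp: ell2_def)
  show "norm_sq V (\<lambda>x. f x + g x) \<le> 2 * norm_sq V f + 2 * norm_sq V g"
    using assms by (intro *(2)) (auto simp: ell2_def)
qed

lemma norm_sq_mult: "norm_sq V (\<lambda>x. c * f x) = (cmod c)\<^sup>2 * norm_sq V f"
  by (simp add: norm_sq_def norm_mult power_mult_distrib infsum_cmult_right')

lemma bounded_opsI:
  assumes "\<And>f. f \<notin> ell2 V \<Longrightarrow> T f = (\<lambda>x. 0)"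
    and "\<And>f. f \<in> ell2 V \<Longrightarrow> T f \<in> ell2 V"
    and "\<And>f g. f \<in> ell2 V \<Longrightarrow> g \<in> ell2 V \<Longrightarrow> T (\<lambda>x. f x + g x) = (\<lambda>x. T f x + T g x)"
    and "\<And>c f. f \<in> ell2 V \<Longrightarrow> T (\<lambda>x. c * f x) = (\<lambda>x. c * T f x)"
    and "\<And>f. f \<in> ell2 V \<Longrightarrow> norm_sq V (T f) \<le> C * norm_sq V f"
  shows "T \<in> bounded_ops V"
proof -
  have "ell2_norm V (T f) \<le> sqrt C * ell2_norm V f" if "f \<in> ell2 V" for f
    using real_sqrt_le_mono[OF assms(5)[OF that]] by (simp add: ell2_norm_eq real_sqrt_mult)
  with assms(1-4) show ?thesis
    unfolding bounded_ops_def by blast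
qed

lemma bounded_opsD:
  assumes "T \<in> bounded_ops V"
  shows "f \<notin> ell2 V \<Longrightarrow> T f = (\<lambda>x. 0)"
    and "f \<in> ell2 V \<Longrightarrow> T f \<in> ell2 V"
    and "T f \<in> ell2 V"
    and "f \<in> ell2 V \<Longrightarrow> g \<in> ell2 V \<Longrightarrow> T (\<lambda>x. f x + g x) = (\<lambda>x. T f x + T g x)"
    and "f \<in> ell2 V \<Longrightarrow> T (\<lambda>x. c * f x) = (\<lambda>x. c * T f x)"
proof -
  have "T f \<in> ell2 V" if "f \<in> ell2 V"
    using assms that by (simp add: bounded_ops_def)
  moreover have "T f \<in> ell2 V" if "f \<notin> ell2 V"
    using assms that ell2_zero[of V] by (simp add: bounded_ops_def)
  ultimately have "T f \<in> ell2 V"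
    by blast
  then show "T f \<in> ell2 V" and "T f \<in> ell2 V"
    by auto
qed (use assms in \<open>auto simp: bounded_ops_def\<close>)

lemma bounded_ops_norm_sq:
  assumes "T \<in> bounded_ops V"
  obtains C where "C \<ge> 0" and "\<And>f. f \<in> ell2 V \<Longrightarrow> norm_sq V (T f) \<le> C * norm_sq V f"
proof -
  obtain C where C: "\<forall>f\<in>ell2 V. ell2_norm V (T f) \<le> C * ell2_norm V f"
    using assms by (auto simp: bounded_ops_def)
  have "norm_sq V (T f) \<le> C\<^sup>2 * norm_sq V f" if "f \<in> ell2 V" for f
  proof -
    have "(ell2_norm V (T f))\<^sup>2 \<le> (C * ell2_norm V f)\<^sup>2"
      using C that by (intro power_mono) (auto simp: ell2_norm_eq norm_sq_nonneg)
    then show ?thesis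
      by (simp add: ell2_norm_eq norm_sq_nonneg power_mult_distrib)
  qed
  then show ?thesis
    using that[of "C\<^sup>2"] by simp
qed

lemma bounded_ops_zero: "(\<lambda>f x. 0) \<in> bounded_ops V"
  by (rule bounded_opsI[where C = 0]) (auto simp: ell2_zero norm_sq_def)

lemma bounded_ops_one: "(\<lambda>f. if f \<in> ell2 V then f else (\<lambda>x. 0)) \<in> bounded_ops V"
  by (rule bounded_opsI[where C = 1]) (auto simp: ell2_add ell2_mult)

lemma bounded_ops_comp:
  assumes S: "S \<in> bounded_ops V" and T: "T \<in> bounded_ops V"
  shows "S \<circ> T \<in> bounded_ops V"
proof -
  obtain C where C: "C \<ge> 0" "\<And>f. f \<in> ell2 V \<Longrightarrow> norm_sq V (S f) \<le> C * norm_sq V f"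
    by (rule bounded_ops_norm_sq[OF S]) blast
  obtain D where D: "D \<ge> 0" "\<And>f. f \<in> ell2 V \<Longrightarrow> norm_sq V (T f) \<le> D * norm_sq V f"
    by (rule bounded_ops_norm_sq[OF T]) blast
  \<comment> \<open>Outside \<open>ell2 V\<close> the value of \<open>T\<close> is the zero
    function, and \<open>S\<close> has to keep it zero.\<close>
  have S0: "S (\<lambda>x. 0) = (\<lambda>x. 0)"
    using bounded_opsD(5)[OF S ell2_zero, of 0] by simp
  show ?thesis
  proof (rule bounded_opsI[where C = "C * D"])
    fix f assume f: "f \<in> ell2 V"
    have "norm_sq V (S (T f)) \<le> C * norm_sq V (T f)"
      by (rule C(2)[OF bounded_opsD(2)[OF T f]])
    also have "\<dots> \<le> C * (D * norm_sq V f)"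
      by (rule mult_left_mono[OF D(2)[OF f] C(1)])
    finally show "norm_sq V ((S \<circ> T) f) \<le> C * D * norm_sq V f"
      by (simp add: mult.assoc)
  qed (simp_all add: bounded_opsD[OF S] bounded_opsD[OF T] S0)
qed

lemma bounded_ops_add:
  assumes S: "S \<in> bounded_ops V" and T: "T \<in> bounded_ops V"
  shows "(\<lambda>f x. S f x + T f x) \<in> bounded_ops V"
proof -
  obtain C where C: "C \<ge> 0" "\<And>f. f \<in> ell2 V \<Longrightarrow> norm_sq V (S f) \<le> C * norm_sq V f"
    by (rule bounded_ops_norm_sq[OF S]) blast
  obtain D where D: "D \<ge> 0" "\<And>f. f \<in> ell2 V \<Longrightarrow> norm_sq V (T f) \<le> D * norm_sq V f"
    by (rule bounded_ops_norm_sq[OF T]) blast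
  show ?thesis
  proof (rule bounded_opsI[where C = "2 * C + 2 * D"])
    fix f assume f: "f \<in> ell2 V"
    have "norm_sq V (\<lambda>x. S f x + T f x) \<le> 2 * norm_sq V (S f) + 2 * norm_sq V (T f)"
      by (rule ell2_add(2)[OF bounded_opsD(2)[OF S f] bounded_opsD(2)[OF T f]])
    then show "norm_sq V (\<lambda>x. S f x + T f x) \<le> (2 * C + 2 * D) * norm_sq V f"
      using C(2)[OF f] D(2)[OF f] by (simp add: algebra_simps)
  qed (simp_all add: bounded_opsD[OF S] bounded_opsD[OF T] ell2_add(1) algebra_simps)
qed

lemma bounded_ops_smult:
  assumes T: "T \<in> bounded_ops V"
  shows "(\<lambda>f x. c * T f x) \<in> bounded_ops V"
proof -
  obtain D where D: "D \<ge> 0" "\<And>f. f \<in> ell2 V \<Longrightarrow> norm_sq V (T f) \<le> D * norm_sq V f"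
    by (rule bounded_ops_norm_sq[OF T]) blast
  show ?thesis
  proof (rule bounded_opsI[where C = "(cmod c)\<^sup>2 * D"])
    fix f assume f: "f \<in> ell2 V"
    show "norm_sq V (\<lambda>x. c * T f x) \<le> (cmod c)\<^sup>2 * D * norm_sq V f"
      using mult_left_mono[OF D(2)[OF f], of "(cmod c)\<^sup>2"] by (simp add: norm_sq_mult mult.assoc)
  qed (simp_all add: bounded_opsD[OF T] ell2_mult algebra_simps)
qed

section \<open>The algebra of bounded operators\<close>

lemma op_algebra_simps:
  "carrier (op_algebra V) = bounded_ops V"
  "S \<otimes>\<^bsub>op_algebra V\<^esub> T = S \<circ> T"
  "\<one>\<^bsub>op_algebra V\<^esub> = (\<lambda>f. if f \<in> ell2 V then f else (\<lambda>x. 0))"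
  "\<zero>\<^bsub>op_algebra V\<^esub> = (\<lambda>f x. 0)"
  "S \<oplus>\<^bsub>op_algebra V\<^esub> T = (\<lambda>f x. S f x + T f x)"
  "c \<odot>\<^bsub>op_algebra V\<^esub> T = (\<lambda>f x. c * T f x)"
  by (simp_all add: op_algebra_def)

text \<open>Subtraction in the record goes through the additive inverse, a definite description over
  the carrier. Boundedness of \<open>T\<close> puts the pointwise negative into the carrier, and
  pointwise cancellation makes it the only candidate.\<close>

lemma op_algebra_minus:
  assumes "T \<in> bounded_ops V"
  shows "S \<ominus>\<^bsub>op_algebra V\<^esub> T = (\<lambda>f x. S f x - T f x)"
proof -
  have "\<ominus>\<^bsub>op_algebra V\<^esub> T = (\<lambda>f x. - T f x)"
    unfolding a_inv_def m_inv_def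
  proof (rule the_equality)
    show "(\<lambda>f x. - T f x) \<in> carrier (add_monoid (op_algebra V)) \<and>
        T \<otimes>\<^bsub>add_monoid (op_algebra V)\<^esub> (\<lambda>f x. - T f x) = \<one>\<^bsub>add_monoid (op_algebra V)\<^esub> \<and>
        (\<lambda>f x. - T f x) \<otimes>\<^bsub>add_monoid (op_algebra V)\<^esub> T = \<one>\<^bsub>add_monoid (op_algebra V)\<^esub>"
      using bounded_ops_smult[OF assms, of "-1"] by (simp add: op_algebra_simps)
  next
    fix U
    assume "U \<in> carrier (add_monoid (op_algebra V)) \<and>
        T \<otimes>\<^bsub>add_monoid (op_algebra V)\<^esub> U = \<one>\<^bsub>add_monoid (op_algebra V)\<^esub> \<and>
        U \<otimes>\<^bsub>add_monoid (op_algebra V)\<^esub> T = \<one>\<^bsub>add_monoid (op_algebra V)\<^esub>"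
    then have "T f x + U f x = 0" for f x
      by (simp add: op_algebra_simps fun_eq_iff)
    then show "U = (\<lambda>f x. - T f x)"
      by (simp add: fun_eq_iff eq_neg_iff_add_eq_0 add.commute)
  qed
  then show ?thesis
    by (simp add: a_minus_def op_algebra_simps)
qed

lemma bounded_ops_minus:
  assumes "S \<in> bounded_ops V" and "T \<in> bounded_ops V"
  shows "S \<ominus>\<^bsub>op_algebra V\<^esub> T \<in> bounded_ops V"
  using bounded_ops_add[OF assms(1) bounded_ops_smult[OF assms(2), of "-1"]]
  by (simp add: op_algebra_minus[OF assms(2)])

lemma monoid_op_algebra: "monoid (op_algebra V)"
proof
  fix T assume T: "T \<in> carrier (op_algebra V)"
  then have T: "T \<in> bounded_ops V"
    by (simp add: op_algebra_simps)
  then show "\<one>\<^bsub>op_algebra V\<^esub> \<otimes>\<^bsub>op_algebra V\<^esub> T = T"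
    by (auto simp: op_algebra_simps fun_eq_iff bounded_opsD(3))
  have "T (\<lambda>x. 0) = (\<lambda>x. 0)"
    using bounded_opsD(5)[OF T ell2_zero, of 0] by simp
  with T show "T \<otimes>\<^bsub>op_algebra V\<^esub> \<one>\<^bsub>op_algebra V\<^esub> = T"
    by (auto simp: op_algebra_simps fun_eq_iff bounded_opsD(1))
qed (simp_all add: op_algebra_simps bounded_ops_comp bounded_ops_one o_assoc)

text \<open>Powers in a monoid append the new factor on the right, which would apply the extra
  \<open>T\<close> first; associativity moves it to the outside, where one-step recursions expect
  it.\<close>

lemma op_algebra_pow_Suc:
  assumes "T \<in> bounded_ops V"
  shows "(T [^]\<^bsub>op_algebra V\<^esub> Suc n) f = T ((T [^]\<^bsub>op_algebra V\<^esub> n) f)"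
  using monoid.nat_pow_Suc2[OF monoid_op_algebra, of T V n] assms
  by (simp add: op_algebra_simps)

lemma op_algebra_pow_ell2:
  assumes "T \<in> bounded_ops V" and "f \<in> ell2 V"
  shows "(T [^]\<^bsub>op_algebra V\<^esub> (n::nat)) f \<in> ell2 V"
  by (induction n)
    (simp_all add: assms op_algebra_pow_Suc bounded_opsD(3)[OF assms(1)] op_algebra_simps del: nat_pow_Suc)

lemma vector_state_delta: "x \<in> V \<Longrightarrow> vector_state V (delta x) T = T (delta x) x"
proof -
  assume x: "x \<in> V"
  have "ell2_inner V f (delta x) = f x" for f
  proof -
    have "(\<Sum>\<^sub>\<infinity>y\<in>V. f y * cnj (delta x y)) = (\<Sum>\<^sub>\<infinity>y\<in>{x}. f y * cnj (delta x y))"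
      using x by (intro infsum_cong_neutral) (auto simp: delta_def)
    then show ?thesis
      by (simp add: ell2_inner_def delta_def)
  qed
  then show ?thesis
    by (simp add: vector_state_def)
qed

text \<open>Cauchy-Schwarz at each vertex costs one factor \<open>d\<close>; exchanging the order of
  summation costs the other, because a vertex is met along at most \<open>d\<close> edges.\<close>

lemma adjacency_op_finite_sum:
  assumes bd: "bounded_degree G"
    and d: "\<And>x. x \<in> verts G \<Longrightarrow> card (incident G x) \<le> d"
    and f: "f \<in> ell2 (verts G)" and F: "finite F" "F \<subseteq> verts G"
  shows "(\<Sum>y\<in>F. (cmod (nbr_sum G f y))\<^sup>2) \<le> (real d)\<^sup>2 * norm_sq (verts G) f"
proof -
  note fin = finite_incident[OF bd]
  define Q where "Q = Sigma F (incident G)"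
  define F' where "F' = (\<lambda>(y, b). opposite G y b) ` Q"
  have Q: "finite Q"
    using F fin by (simp add: Q_def)
  have F': "finite F'" "F' \<subseteq> verts G"
    using Q bounded_degree_opposite[OF bd] by (auto simp: F'_def Q_def)
  have "(cmod (nbr_sum G f y))\<^sup>2 \<le> real d * (\<Sum>b\<in>incident G y. (cmod (f (opposite G y b)))\<^sup>2)"
    if "y \<in> F" for y
  proof -
    have "(cmod (nbr_sum G f y))\<^sup>2 \<le> (\<Sum>b\<in>incident G y. cmod (f (opposite G y b)))\<^sup>2"
      unfolding nbr_sum_def by (intro power_mono norm_sum) simp
    also have "\<dots> \<le> real (card (incident G y)) * (\<Sum>b\<in>incident G y. (cmod (f (opposite G y b)))\<^sup>2)"
      using sum_squared_le_sum_of_squares[of "\<lambda>b. cmod (f (opposite G y b))" "incident G y"]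
      by (simp add: mult.commute)
    also have "\<dots> \<le> real d * (\<Sum>b\<in>incident G y. (cmod (f (opposite G y b)))\<^sup>2)"
      using d[of y] that F by (intro mult_right_mono sum_nonneg) auto
    finally show ?thesis .
  qed
  then have "(\<Sum>y\<in>F. (cmod (nbr_sum G f y))\<^sup>2) \<le>
      (\<Sum>y\<in>F. real d * (\<Sum>b\<in>incident G y. (cmod (f (opposite G y b)))\<^sup>2))"
    by (rule sum_mono)
  also have "\<dots> = real d * (\<Sum>(y, b)\<in>Q. (cmod (f (opposite G y b)))\<^sup>2)"
    using F fin by (simp add: Q_def sum.Sigma sum_distrib_left[symmetric])
  also have "(\<Sum>(y, b)\<in>Q. (cmod (f (opposite G y b)))\<^sup>2) =
      (\<Sum>p\<in>(\<lambda>(y, b). (opposite G y b, b)) ` Q. (cmod (f (fst p)))\<^sup>2)"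
  proof (subst sum.reindex)
    \<comment> \<open>Traversing the edge backwards is an involution on pairs of a vertex and an
      incident edge, so no term is lost or doubled.\<close>
    show "inj_on (\<lambda>(y, b). (opposite G y b, b)) Q"
      by (rule inj_on_inverseI[where g = "\<lambda>(x, b). (opposite G x b, b)"])
        (auto simp: Q_def incident_opposite)
  qed (auto intro: sum.cong)
  also have "\<dots> \<le> (\<Sum>p\<in>Sigma F' (incident G). (cmod (f (fst p)))\<^sup>2)"
    using F' fin by (intro sum_mono2) (auto simp: Q_def F'_def intro: incident_opposite)
  also have "\<dots> = (\<Sum>x\<in>F'. real (card (incident G x)) * (cmod (f x))\<^sup>2)"
    using F' fin sum.Sigma[of F' "incident G" "\<lambda>x b. (cmod (f x))\<^sup>2"] by (simp add: split_def)
  also have "\<dots> \<le> (\<Sum>x\<in>F'. real d * (cmod (f x))\<^sup>2)"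
    using F' d by (intro sum_mono mult_right_mono) auto
  also have "\<dots> \<le> real d * norm_sq (verts G) f"
    using sum_le_norm_sq[OF f F'] by (simp add: sum_distrib_left[symmetric] mult_left_mono)
  finally show ?thesis
    by (simp add: power2_eq_square mult.assoc mult_left_mono)
qed

lemma adjacency_op_bounded:
  assumes bd: "bounded_degree G"
  shows "adjacency_op G \<in> bounded_ops (verts G)"
proof -
  obtain d where d: "\<And>x. x \<in> verts G \<Longrightarrow> card (incident G x) \<le> d"
    using bd by (auto simp: bounded_degree_def uniformly_locally_finite_def incident_def)
  have *: "(\<Sum>y\<in>F. (cmod (adjacency_op G f y))\<^sup>2) \<le> (real d)\<^sup>2 * norm_sq (verts G) f"
    if "f \<in> ell2 (verts G)" "finite F" "F \<subseteq> verts G" for f F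
    using adjacency_op_finite_sum[OF bd d that] that(3)
    by (simp add: adjacency_op_eq[OF bd that(1)] subset_iff)
  have 0: "adjacency_op G f x = 0" if "x \<notin> verts G" for f x
    using that by (simp add: adjacency_op_def)
  show ?thesis
  proof (rule bounded_opsI[where C = "(real d)\<^sup>2"])
    fix f assume f: "f \<in> ell2 (verts G)"
    show "adjacency_op G f \<in> ell2 (verts G)"
      "norm_sq (verts G) (adjacency_op G f) \<le> (real d)\<^sup>2 * norm_sq (verts G) f"
      by (rule ell2I_finite_sums[OF 0 *[OF f]], assumption+)+
    fix c
    show "adjacency_op G (\<lambda>x. c * f x) = (\<lambda>x. c * adjacency_op G f x)"
      using f by (simp add: adjacency_op_eq[OF bd] ell2_mult nbr_sum_mult_left fun_eq_iff)
    fix g assume g: "g \<in> ell2 (verts G)"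
    show "adjacency_op G (\<lambda>x. f x + g x) = (\<lambda>x. adjacency_op G f x + adjacency_op G g x)"
      using f g by (simp add: adjacency_op_eq[OF bd] ell2_add nbr_sum_add fun_eq_iff)
  qed (simp add: adjacency_op_def)
qed

section \<open>Generated subalgebras\<close>

lemma subalg_bounded_ops: "subalg (op_algebra V) (bounded_ops V)"
  by (simp add: subalg_def op_algebra_simps bounded_ops_zero bounded_ops_add bounded_ops_comp
      bounded_ops_smult)

lemma subalg_Inter:
  assumes "F \<noteq> {}" and "\<And>A. A \<in> F \<Longrightarrow> subalg M A"
  shows "subalg M (\<Inter>F)"
proof -
  obtain A where "A \<in> F"
    using assms(1) by auto
  then have "\<Inter>F \<subseteq> carrier M"
    using assms(2)[of A] by (auto simp: subalg_def)
  then show ?thesis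
    using assms(2) by (simp add: subalg_def)
qed

text \<open>The bounded operators are themselves one of the subalgebras in the intersection, so the
  hull is taken over a nonempty family and stays inside the carrier.\<close>

lemma subalg_alg:
  assumes "S \<subseteq> bounded_ops V"
  shows "subalg (op_algebra V) (alg (op_algebra V) S)"
  unfolding alg_def hull_def by (rule subalg_Inter) (use subalg_bounded_ops[of V] assms in auto)

lemma subset_alg: "S \<subseteq> alg M S"
  unfolding alg_def by (rule hull_subset)

lemma alg_minimal: "S \<subseteq> A \<Longrightarrow> subalg M A \<Longrightarrow> alg M S \<subseteq> A"
  unfolding alg_def by (rule hull_minimal)

section \<open>First-return series of a rooted graph\<close>

text \<open>\<open>hit_coeff G r k v\<close> counts the walks of length \<open>k + 1\<close> from \<open>v\<close> that reach \<open>r\<close> for the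
  first time (after the start) at their end.\<close>

primrec hit_coeff :: "('v, 'e, 'z) mgraph_scheme \<Rightarrow> 'v \<Rightarrow> nat \<Rightarrow> 'v \<Rightarrow> complex" where
  "hit_coeff G r 0 v = nbr_sum G (\<lambda>y. if y = r then 1 else 0) v"
| "hit_coeff G r (Suc k) v = nbr_sum G (\<lambda>y. if y = r then 0 else hit_coeff G r k y) v"

text \<open>With the exponent one less than the length, this series becomes
  \<open>rho_series\<close> at \<open>v = r\<close>; multiplied by \<open>fps_X\<close> it counts by
  length.\<close>

definition hit_series :: "('v, 'e, 'z) mgraph_scheme \<Rightarrow> 'v \<Rightarrow> 'v \<Rightarrow> complex fps" where
  "hit_series G r v = Abs_fps (\<lambda>k. hit_coeff G r k v)"

text \<open>Decomposition by the first step; the factor \<open>fps_X\<close> makes up for the edge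
  just used.\<close>

lemma hit_series_eq:
  "hit_series G r v = nbr_sum G (\<lambda>y. if y = r then 1 else fps_X * hit_series G r y) v"
proof (rule fps_ext)
  fix n
  show "fps_nth (hit_series G r v) n =
      fps_nth (nbr_sum G (\<lambda>y. if y = r then 1 else fps_X * hit_series G r y) v) n"
  proof (cases n)
    case 0
    have "fps_nth (if y = r then 1 else fps_X * hit_series G r y) 0 = (if y = r then 1 else 0)" for y
      by simp
    then show ?thesis
      by (simp add: 0 hit_series_def fps_nth_nbr_sum)
  next
    case (Suc k)
    have "fps_nth (if y = r then 1 else fps_X * hit_series G r y) (Suc k) =
        (if y = r then 0 else hit_coeff G r k y)" for y
      by (simp add: hit_series_def)
    then show ?thesis
      by (simp add: Suc hit_series_def fps_nth_nbr_sum)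
  qed
qed

section \<open>Moments and the eta series\<close>

lemma psi_series_nth_0 [simp]: "fps_nth (psi_series \<mu>) 0 = 0"
  by (simp add: psi_series_def)

lemma psi_series_eq: "psi_series \<mu> = eta_series \<mu> + eta_series \<mu> * psi_series \<mu>"
proof -
  have u: "fps_nth (1 + psi_series \<mu>) 0 \<noteq> 0"
    by simp
  have "eta_series \<mu> * (1 + psi_series \<mu>) = psi_series \<mu> * (inverse (1 + psi_series \<mu>) * (1 + psi_series \<mu>))"
    unfolding eta_series_def fps_divide_unit[OF u] by (simp only: mult.assoc)
  then show ?thesis
    unfolding inverse_mult_eq_1[OF u] by (simp add: algebra_simps)
qed

lemma eta_series_nth_0 [simp]: "fps_nth (eta_series \<mu>) 0 = 0"
  using arg_cong[OF psi_series_eq[of \<mu>], of "\<lambda>f. fps_nth f 0"] by simp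

text \<open>The hypothesis is a renewal equation for the moment series 1 + psi, whose constant term
  1 makes it cancellable.\<close>

lemma eta_seriesI:
  assumes "1 + psi_series \<mu> = 1 + h * (1 + psi_series \<mu>)"
  shows "eta_series \<mu> = h"
proof -
  have "(1 + psi_series \<mu>) * eta_series \<mu> = (1 + psi_series \<mu>) * h"
    using assms psi_series_eq[of \<mu>] by (simp add: algebra_simps)
  moreover have "1 + psi_series \<mu> \<noteq> 0"
  proof
    assume "1 + psi_series \<mu> = 0"
    from arg_cong[OF this, of "\<lambda>f. fps_nth f 0"] show False
      by simp
  qed
  ultimately show ?thesis
    by simp
qed

lemma one_plus_psi_series_distribution:
  fixes M :: "(complex, 'm) module"
  assumes "\<phi> \<one>\<^bsub>M\<^esub> = 1"
  shows "1 + psi_series (distribution M \<phi> a) = Abs_fps (\<lambda>n. \<phi> (a [^]\<^bsub>M\<^esub> n))"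
  by (rule fps_ext)
    (use assms in \<open>auto simp: psi_series_def distribution_def moment_functional_of_moments nat_pow_def\<close>)

lemma vector_state_delta_one:
  "x \<in> V \<Longrightarrow> vector_state V (delta x) \<one>\<^bsub>op_algebra V\<^esub> = 1"
  by (simp add: vector_state_delta op_algebra_simps delta_in_ell2) (simp add: delta_def)

text \<open>A walk from \<open>v\<close> to \<open>r\<close> splits at its first visit to
  \<open>r\<close> into a hitting walk and a closed walk at \<open>r\<close>, counted by
  \<open>U\<close>; for \<open>v = r\<close> this is the renewal equation of
  \<open>eta_seriesI\<close>.\<close>

lemma rho_series_spectral_distribution:
  assumes "rooted_graph G r"
  shows "eta_series (spectral_distribution G r) = fps_X * hit_series G r r"
    and "rho_series (spectral_distribution G r) = hit_series G r r"
proof -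
  note bd = rooted_graph_bounded_degree[OF assms]
  have r: "r \<in> verts G"
    using assms by (simp add: rooted_graph_def)
  let ?M = "op_algebra (verts G)"
  define a where "a n = (adjacency_op G [^]\<^bsub>?M\<^esub> n) (delta r)" for n :: nat
  define U where "U = Abs_fps (\<lambda>n. a n r)"
  have a0: "a 0 = delta r"
    by (simp add: a_def op_algebra_simps delta_in_ell2 r)
  have aS: "a (Suc n) v = nbr_sum G (a n) v" if "v \<in> verts G" for n v
    using that op_algebra_pow_ell2[OF adjacency_op_bounded[OF bd] delta_in_ell2[OF r], of n]
    by (simp add: a_def op_algebra_pow_Suc[OF adjacency_op_bounded[OF bd]] adjacency_op_eq[OF bd] del: nat_pow_Suc)
  \<comment> \<open>The first summand is the empty walk at \<open>r\<close>. There is no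
    circularity: the coefficients of \<open>U\<close> are the numbers \<open>a n r\<close> by
    definition, so the induction hypothesis serves the neighbours other than
    \<open>r\<close>.\<close>
  have a: "a n v = fps_nth ((if v = r then 1 else 0) + fps_X * hit_series G r v * U) n"
    if "v \<in> verts G" for n v
    using that
  proof (induction n arbitrary: v)
    case 0
    then show ?case
      by (simp add: a0 delta_def)
  next
    case (Suc n)
    have "a (Suc n) v = nbr_sum G (\<lambda>y. fps_nth ((if y = r then 1 else fps_X * hit_series G r y) * U) n) v"
      unfolding aS[OF Suc.prems]
    proof (rule nbr_sum_cong)
      fix b assume "b \<in> incident G v"
      then show "a n (opposite G v b) =
          fps_nth ((if opposite G v b = r then 1 else fps_X * hit_series G r (opposite G v b)) * U) n"
        using Suc.IH[OF bounded_degree_opposite[OF bd]]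
        by (cases "opposite G v b = r") (simp_all add: U_def)
    qed
    also have "\<dots> = fps_nth (hit_series G r v * U) n"
      by (subst (2) hit_series_eq) (simp only: nbr_sum_mult_right[symmetric] fps_nth_nbr_sum)
    also have "\<dots> = fps_nth ((if v = r then 1 else 0) + fps_X * hit_series G r v * U) (Suc n)"
      by (simp add: mult.assoc)
    finally show ?case .
  qed
  have psi: "1 + psi_series (spectral_distribution G r) = U"
    unfolding spectral_distribution_def
    using one_plus_psi_series_distribution[of "vector_state (verts G) (delta r)" ?M "adjacency_op G",
        OF vector_state_delta_one[OF r]]
    by (simp add: vector_state_delta r U_def a_def)
  have "U = 1 + fps_X * hit_series G r r * U"
  proof (rule fps_ext)
    fix n
    have "fps_nth U n = a n r"
      by (simp add: U_def)
    then show "fps_nth U n = fps_nth (1 + fps_X * hit_series G r r * U) n"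
      using a[OF r, of n] by simp
  qed
  then show eta: "eta_series (spectral_distribution G r) = fps_X * hit_series G r r"
    by (intro eta_seriesI) (simp only: psi)
  show "rho_series (spectral_distribution G r) = hit_series G r r"
    unfolding rho_series_def eta by (rule nonzero_mult_div_cancel_left) simp
qed

section \<open>The s-free multiplicative convolution\<close>

text \<open>Congruence modulo the (n+1)-st power of the variable.\<close>

definition fps_agree :: "nat \<Rightarrow> 'a::zero fps \<Rightarrow> 'a fps \<Rightarrow> bool" where
  "fps_agree n f g \<longleftrightarrow> (\<forall>i\<le>n. fps_nth f i = fps_nth g i)"

lemma fps_agree_mult:
  "fps_agree n f f' \<Longrightarrow> fps_agree n g g' \<Longrightarrow> fps_agree n (f * g) (f' * g' :: 'a::comm_ring_1 fps)"
  by (auto simp: fps_agree_def fps_mult_nth intro!: sum.cong)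

lemma fps_agree_power:
  "fps_agree n f g \<Longrightarrow> fps_agree n (f ^ k) (g ^ k :: 'a::comm_ring_1 fps)"
  by (induction k) (simp_all add: fps_agree_mult fps_agree_def[of _ 1])

text \<open>The outer factor \<open>fps_X\<close> gains one order of agreement; this contraction
  makes the iterated convolutions stabilize.\<close>

lemma fps_agree_X_compose:
  assumes "fps_agree n f g"
  shows "fps_agree (Suc n) (fps_X * (h oo f)) (fps_X * (h oo g) :: 'a::comm_ring_1 fps)"
  using fps_agree_power[OF assms]
  by (auto simp: fps_agree_def fps_compose_nth intro!: sum.cong)

text \<open>In psi = eta + eta * psi the series eta has no constant term, so each coefficient of psi
  depends only on eta and on earlier coefficients of psi.\<close>

lemma fps_agree_psi_series:
  assumes "fps_agree n (eta_series \<mu>) (eta_series \<nu>)"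
  shows "fps_agree n (psi_series \<mu>) (psi_series \<nu>)"
proof -
  have "i \<le> n \<Longrightarrow> fps_nth (psi_series \<mu>) i = fps_nth (psi_series \<nu>) i" for i
  proof (induction i rule: less_induct)
    case (less i)
    have "fps_nth (eta_series \<mu>) j * fps_nth (psi_series \<mu>) (i - j) =
        fps_nth (eta_series \<nu>) j * fps_nth (psi_series \<nu>) (i - j)" if "j \<le> i" for j
      using less.IH[of "i - j"] less.prems assms that by (cases "j = 0") (auto simp: fps_agree_def)
    then have "fps_nth (eta_series \<mu> * psi_series \<mu>) i = fps_nth (eta_series \<nu> * psi_series \<nu>) i"
      by (auto simp: fps_mult_nth intro!: sum.cong)
    then have "fps_nth (eta_series \<mu> + eta_series \<mu> * psi_series \<mu>) i =
        fps_nth (eta_series \<nu> + eta_series \<nu> * psi_series \<nu>) i"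
      using assms less.prems by (simp add: fps_agree_def)
    then show ?case
      by (simp only: psi_series_eq[symmetric])
  qed
  then show ?thesis
    by (simp add: fps_agree_def)
qed

text \<open>The two measures swap roles at each level, hence the induction over arbitrary
  \<open>\<mu>1\<close> and \<open>\<mu>2\<close>; it starts from the vanishing constant
  terms.\<close>

lemma eta_series_orth_conv_iter_agree:
  "fps_agree (Suc n) (eta_series (orth_conv_iter (Suc n) \<mu>1 \<mu>2)) (eta_series (orth_conv_iter (Suc (Suc n)) \<mu>1 \<mu>2))"
proof (induction n arbitrary: \<mu>1 \<mu>2)
  case 0
  show ?case
    unfolding orth_conv_iter.simps eta_series_orth_conv
    by (rule fps_agree_X_compose) (simp add: fps_agree_def)
next
  case (Suc n)
  have "fps_agree (Suc (Suc n)) (eta_series (orth_conv \<mu>1 (orth_conv_iter (Suc n) \<mu>2 \<mu>1)))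
      (eta_series (orth_conv \<mu>1 (orth_conv_iter (Suc (Suc n)) \<mu>2 \<mu>1)))"
    unfolding eta_series_orth_conv by (rule fps_agree_X_compose[OF Suc.IH])
  then show ?case
    by simp
qed

text \<open>Diagonal limit: each coefficient is read off an iterate in which it has already
  settled.\<close>

definition sfree_eta :: "(complex poly \<Rightarrow> complex) \<Rightarrow> (complex poly \<Rightarrow> complex) \<Rightarrow> complex fps" where
  "sfree_eta \<mu>1 \<mu>2 = Abs_fps (\<lambda>k. fps_nth (eta_series (orth_conv_iter (Suc k) \<mu>1 \<mu>2)) k)"

lemma sfree_eta_agree:
  "fps_agree (Suc n) (eta_series (orth_conv_iter (Suc n) \<mu>1 \<mu>2)) (sfree_eta \<mu>1 \<mu>2)"
proof -
  let ?e = "\<lambda>n. eta_series (orth_conv_iter (Suc n) \<mu>1 \<mu>2)"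
  have *: "fps_nth (?e (i + d)) i = fps_nth (?e i) i" for i d
    using eta_series_orth_conv_iter_agree[of "i + _" \<mu>1 \<mu>2]
    by (induction d) (auto simp: fps_agree_def simp del: orth_conv_iter.simps)
  have "fps_nth (?e n) i = fps_nth (sfree_eta \<mu>1 \<mu>2) i" if "i \<le> n" for i
    using *[of i "n - i"] that by (simp add: sfree_eta_def del: orth_conv_iter.simps)
  moreover have "fps_nth (?e n) (Suc n) = fps_nth (sfree_eta \<mu>1 \<mu>2) (Suc n)"
    using eta_series_orth_conv_iter_agree[of n \<mu>1 \<mu>2]
    by (simp add: fps_agree_def sfree_eta_def del: orth_conv_iter.simps)
  ultimately show ?thesis
    by (auto simp: fps_agree_def le_Suc_eq simp del: orth_conv_iter.simps)
qed

lemma sfree_eta_nth_0 [simp]: "fps_nth (sfree_eta \<mu>1 \<mu>2) 0 = 0"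
  by (simp add: sfree_eta_def)

text \<open>Every coefficient of the limit is attained at a finite stage, so the recursion of the
  iterates passes to the limit coefficient by coefficient.\<close>

lemma sfree_eta_eq:
  "sfree_eta \<mu>1 \<mu>2 = fps_X * (rho_series \<mu>1 oo sfree_eta \<mu>2 \<mu>1)"
proof (rule fps_ext)
  fix k
  have "fps_nth (sfree_eta \<mu>1 \<mu>2) k = fps_nth (eta_series (orth_conv_iter (Suc (Suc k)) \<mu>1 \<mu>2)) k"
    using sfree_eta_agree[of "Suc k" \<mu>1 \<mu>2] by (simp add: fps_agree_def del: orth_conv_iter.simps)
  also have "\<dots> = fps_nth (fps_X * (rho_series \<mu>1 oo eta_series (orth_conv_iter (Suc k) \<mu>2 \<mu>1))) k"
    by (simp add: eta_series_orth_conv)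
  also have "\<dots> = fps_nth (fps_X * (rho_series \<mu>1 oo sfree_eta \<mu>2 \<mu>1)) k"
    using fps_agree_X_compose[OF sfree_eta_agree[of k \<mu>2 \<mu>1], of "rho_series \<mu>1"]
    by (simp add: fps_agree_def)
  finally show "fps_nth (sfree_eta \<mu>1 \<mu>2) k = fps_nth (fps_X * (rho_series \<mu>1 oo sfree_eta \<mu>2 \<mu>1)) k" .
qed

lemma unital_functional_moment_0: "unital_functional \<mu> \<Longrightarrow> moment \<mu> 0 = 1"
  by (simp add: unital_functional_def moment_def)

lemma unital_functional_orth_conv_iter: "unital_functional (orth_conv_iter (Suc n) \<mu>1 \<mu>2)"
  by (cases n) (simp_all add: unital_functional_orth_conv)

lemma eta_series_sfree_conv: "eta_series (sfree_conv \<mu>1 \<mu>2) = sfree_eta \<mu>1 \<mu>2"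
proof -
  obtain \<mu> where \<mu>: "unital_functional \<mu>" "eta_series \<mu> = sfree_eta \<mu>1 \<mu>2"
    using ex1_eta_series[OF sfree_eta_nth_0] by blast
  have "lim (\<lambda>n. moment (orth_conv_iter n \<mu>1 \<mu>2) k) = moment \<mu> k" for k
  proof (rule limI, rule tendsto_eventually)
    show "eventually (\<lambda>n. moment (orth_conv_iter n \<mu>1 \<mu>2) k = moment \<mu> k) sequentially"
      unfolding eventually_sequentially
    proof (intro exI allI impI)
      \<comment> \<open>From here on the moment is constant in \<open>n\<close>; index 0, where the
        iterated convolution is unspecified, is left out.\<close>
      fix n assume "Suc k \<le> n"
      then obtain m where m: "n = Suc m" "k \<le> m"
        by (cases n) auto
      have "fps_nth (psi_series (orth_conv_iter n \<mu>1 \<mu>2)) k = fps_nth (psi_series \<mu>) k"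
        using fps_agree_psi_series[of "Suc m" "orth_conv_iter n \<mu>1 \<mu>2" \<mu>]
          sfree_eta_agree[of m \<mu>1 \<mu>2] m \<mu>(2) by (simp add: fps_agree_def del: orth_conv_iter.simps)
      then show "moment (orth_conv_iter n \<mu>1 \<mu>2) k = moment \<mu> k"
        using m unital_functional_moment_0[OF \<mu>(1)]
          unital_functional_moment_0[OF unital_functional_orth_conv_iter, of m \<mu>1 \<mu>2]
        by (cases "k = 0") (auto simp: psi_series_def simp del: orth_conv_iter.simps)
    qed
  qed
  then have "sfree_conv \<mu>1 \<mu>2 = \<mu>"
    using unital_functional_eq_moments[OF \<mu>(1)] by (simp add: sfree_conv_def)
  then show ?thesis
    by (simp add: \<mu>(2))
qed

section \<open>Structure of the s-free loop product\<close>

text \<open>The oldest letter of a vertex of the s-free product comes from the first graph and the letters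
  alternate, so the parity of the length decides which graph the newest letter comes from.\<close>

fun sfree_word :: "'a set \<Rightarrow> 'b set \<Rightarrow> ('a + 'b) list \<Rightarrow> bool" where
  "sfree_word A B [] \<longleftrightarrow> True"
| "sfree_word A B (Inl v # w) \<longleftrightarrow> v \<in> A \<and> even (length w) \<and> sfree_word A B w"
| "sfree_word A B (Inr v # w) \<longleftrightarrow> v \<in> B \<and> odd (length w) \<and> sfree_word A B w"

text \<open>A word is the root of the copy attached at it and may also be a non-root vertex of an
  older copy. Fixing the parity of the attaching words removes the ambiguity: the parity of the
  glued word then tells whether the letter is the root. Hence copies of one color are
  disjoint.\<close>

lemma glue_eq_iff:
  assumes "even (length w) \<longleftrightarrow> even (length w')" and "inj i"
  shows "glue r i w v = glue r i w' v' \<longleftrightarrow> w = w' \<and> v = v'"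
proof
  assume eq: "glue r i w v = glue r i w' v'"
  have "even (length (glue r i u y)) \<longleftrightarrow> (even (length u) \<longleftrightarrow> y = r)" for u y
    by (simp add: glue_def)
  then have "v = r \<longleftrightarrow> v' = r"
    using assms(1) eq by metis
  with eq show "w = w' \<and> v = v'"
    using assms(2) by (auto simp: glue_def inj_eq split: if_splits)
qed simp

lemma uniformly_locally_finite_iff:
  "uniformly_locally_finite G \<longleftrightarrow> (\<exists>d. \<forall>x\<in>verts G. finite (incident G x) \<and> card (incident G x) \<le> d)"
  by (simp add: uniformly_locally_finite_def incident_def)

lemma color_subgraph_simps [simp]:
  "verts (color_subgraph G k) = verts G"
  "edges (color_subgraph G k) = {b\<in>edges G. color G b = k}"
  "ends (color_subgraph G k) = ends G"
  by (simp_all add: color_subgraph_def)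

lemma incident_color_subgraph: "incident (color_subgraph G k) x = {b\<in>incident G x. color G b = k}"
  by (auto simp: incident_def)

lemma opposite_color_subgraph [simp]: "opposite (color_subgraph G k) = opposite G"
  by (simp add: opposite_def fun_eq_iff)

lemma glue_nonempty: "odd (length w) \<Longrightarrow> glue r i w v \<noteq> []"
  by (auto simp: glue_def)

locale rooted_graph_pair =
  fixes G1 :: "('a, 'c) mgraph" and e1 :: 'a and G2 :: "('b, 'd) mgraph" and e2 :: 'b
  assumes rooted1: "rooted_graph G1 e1" and rooted2: "rooted_graph G2 e2"
begin

abbreviation word :: "('a + 'b) list \<Rightarrow> bool" where
  "word \<equiv> sfree_word (verts G1 - {e1}) (verts G2 - {e2})"

abbreviation P :: "(('a + 'b) list, (('a + 'b) list \<times> ('c + 'd)) option) cgraph" where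
  "P \<equiv> sfree_loop_product G1 e1 G2 e2"

definition C1 where "C1 = color_subgraph P 1"
definition C2 where "C2 = color_subgraph P 2"

lemma C1_simps [simp]: "verts C1 = verts P" "ends C1 = ends P" "opposite C1 = opposite P"
  by (simp_all add: C1_def)

lemma C2_simps [simp]: "verts C2 = verts P" "ends C2 = ends P" "opposite C2 = opposite P"
  by (simp_all add: C2_def)

lemma root_in_verts: "e1 \<in> verts G1" "e2 \<in> verts G2"
  using rooted1 rooted2 by (auto simp: rooted_graph_def)

lemma bounded_degree12: "bounded_degree G1" "bounded_degree G2"
  using rooted1 rooted2 by (auto intro: rooted_graph_bounded_degree)

lemma word_glue1:
  "even (length w) \<Longrightarrow> word (glue e1 Inl w v) \<longleftrightarrow> word w \<and> v \<in> verts G1"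
  using root_in_verts by (auto simp: glue_def)

lemma word_glue2:
  "odd (length w) \<Longrightarrow> word (glue e2 Inr w v) \<longleftrightarrow> word w \<and> v \<in> verts G2"
  using root_in_verts by (auto simp: glue_def)

text \<open>A word of even length is the root of the copy attached at itself; a word of odd length
  has its newest letter in the first graph.\<close>

lemma word_cases1:
  assumes "word x"
  obtains w v where "even (length w)" "word w" "v \<in> verts G1" "x = glue e1 Inl w v"
proof (cases "even (length x)")
  case True
  then show ?thesis
    using that[of x e1] assms root_in_verts by (simp add: glue_def)
next
  case False
  then obtain v w where "x = Inl v # w"
    using assms by (cases "(verts G1 - {e1}, verts G2 - {e2}, x)" rule: sfree_word.cases) auto
  then show ?thesis
    using that[of w v] assms by (simp add: glue_def)
qed

lemma word_cases2:
  assumes "word x" and "x \<noteq> []"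
  obtains w v where "odd (length w)" "word w" "v \<in> verts G2" "x = glue e2 Inr w v"
proof (cases "odd (length x)")
  case True
  then show ?thesis
    using that[of x e2] assms root_in_verts by (simp add: glue_def)
next
  case False
  then obtain v w where "x = Inr v # w"
    using assms by (cases "(verts G1 - {e1}, verts G2 - {e2}, x)" rule: sfree_word.cases) auto
  then show ?thesis
    using that[of w v] assms by (simp add: glue_def)
qed

lemma UN_glue1:
  assumes "even k"
  shows "(\<Union>w\<in>{w. word w \<and> length w = k}. glue e1 Inl w ` verts G1) =
    {w. word w \<and> (length w = k \<or> length w = Suc k)}"
proof (intro equalityI subsetI)
  fix x assume "x \<in> (\<Union>w\<in>{w. word w \<and> length w = k}. glue e1 Inl w ` verts G1)"
  then show "x \<in> {w. word w \<and> (length w = k \<or> length w = Suc k)}"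
    using assms by (auto simp: word_glue1) (auto simp: glue_def split: if_splits)
next
  fix x assume x: "x \<in> {w. word w \<and> (length w = k \<or> length w = Suc k)}"
  then obtain w v where w: "even (length w)" "word w" "v \<in> verts G1" "x = glue e1 Inl w v"
    by (auto elim: word_cases1)
  with x have "length w = k"
    using assms by (auto simp: glue_def split: if_splits)
  with w show "x \<in> (\<Union>w\<in>{w. word w \<and> length w = k}. glue e1 Inl w ` verts G1)"
    by blast
qed

lemma UN_glue2:
  assumes "odd k"
  shows "(\<Union>w\<in>{w. word w \<and> length w = k}. glue e2 Inr w ` verts G2) =
    {w. word w \<and> (length w = k \<or> length w = Suc k)}"
proof (intro equalityI subsetI)
  fix x assume "x \<in> (\<Union>w\<in>{w. word w \<and> length w = k}. glue e2 Inr w ` verts G2)"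
  then show "x \<in> {w. word w \<and> (length w = k \<or> length w = Suc k)}"
    using assms by (auto simp: word_glue2) (auto simp: glue_def split: if_splits)
next
  fix x assume x: "x \<in> {w. word w \<and> (length w = k \<or> length w = Suc k)}"
  then have "x \<noteq> []"
    using assms by auto
  with x obtain w v where w: "odd (length w)" "word w" "v \<in> verts G2" "x = glue e2 Inr w v"
    by (auto elim: word_cases2)
  with x have "length w = k"
    using assms by (auto simp: glue_def split: if_splits)
  with w show "x \<in> (\<Union>w\<in>{w. word w \<and> length w = k}. glue e2 Inr w ` verts G2)"
    by blast
qed

section \<open>Vertices and edges of the stages\<close>

definition copy_edges :: "(('a + 'b) list \<Rightarrow> bool) \<Rightarrow> (('a + 'b) list \<times> ('c + 'd)) set" where
  "copy_edges Q = {(w, Inl b) | w b. word w \<and> Q w \<and> even (length w) \<and> b \<in> edges G1} \<union>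
     {(w, Inr b) | w b. word w \<and> Q w \<and> odd (length w) \<and> b \<in> edges G2}"

lemma UN_copy_edges1:
  "even k \<Longrightarrow> (\<Union>w\<in>{w. word w \<and> length w = k}. (\<lambda>b. (w, Inl b)) ` edges G1) = copy_edges (\<lambda>w. length w = k)"
  unfolding copy_edges_def by blast

lemma UN_copy_edges2:
  "odd k \<Longrightarrow> (\<Union>w\<in>{w. word w \<and> length w = k}. (\<lambda>b. (w, Inr b)) ` edges G2) = copy_edges (\<lambda>w. length w = k)"
  unfolding copy_edges_def by blast

lemma copy_edges_Un: "copy_edges Q \<union> copy_edges Q' = copy_edges (\<lambda>w. Q w \<or> Q' w)"
  unfolding copy_edges_def by blast

lemma attach_simps:
  "verts (attach G r i j S B) = verts B \<union> (\<Union>w\<in>S. glue r i w ` verts G)"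
  "edges (attach G r i j S B) = edges B \<union> (\<Union>w\<in>S. (\<lambda>b. (w, j b)) ` edges G)"
  by (simp_all add: attach_def)

lemma sfree_stage_0:
  "verts (sfree_stage G1 e1 G2 e2 0) = {w. word w \<and> length w \<le> Suc 0} \<and>
   edges (sfree_stage G1 e1 G2 e2 0) = copy_edges (\<lambda>w. length w \<le> 0)"
proof -
  have "{w. word w \<and> length w = 0} = {[]}"
    by auto
  then show ?thesis
    using UN_glue1[of 0] UN_copy_edges1[of 0] by (simp add: le_Suc_eq)
qed

text \<open>One attachment step for both colors: \<open>k\<close> is the length of the words that
  receive a copy, and its parity selects the graph.\<close>

lemma sfree_stage_step:
  fixes B :: "(('a + 'b) list, ('a + 'b) list \<times> ('c + 'd)) mgraph"
  assumes "verts B = {w. word w \<and> length w \<le> k}" and "edges B = copy_edges (\<lambda>w. length w < k)"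
    and "N = {w. word w \<and> length w = k}"
  shows "even k \<Longrightarrow> verts (attach G1 e1 Inl Inl N B) = {w. word w \<and> length w \<le> Suc k} \<and>
      edges (attach G1 e1 Inl Inl N B) = copy_edges (\<lambda>w. length w < Suc k)"
    and "odd k \<Longrightarrow> verts (attach G2 e2 Inr Inr N B) = {w. word w \<and> length w \<le> Suc k} \<and>
      edges (attach G2 e2 Inr Inr N B) = copy_edges (\<lambda>w. length w < Suc k)"
proof -
  have "{w. word w \<and> length w \<le> k} \<union> {w. word w \<and> (length w = k \<or> length w = Suc k)} =
      {w. word w \<and> length w \<le> Suc k}"
    by auto
  moreover have "(\<lambda>w :: ('a + 'b) list. length w < k \<or> length w = k) = (\<lambda>w. length w < Suc k)"
    by auto
  ultimately show "even k \<Longrightarrow> verts (attach G1 e1 Inl Inl N B) = {w. word w \<and> length w \<le> Suc k} \<and>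
      edges (attach G1 e1 Inl Inl N B) = copy_edges (\<lambda>w. length w < Suc k)"
    and "odd k \<Longrightarrow> verts (attach G2 e2 Inr Inr N B) = {w. word w \<and> length w \<le> Suc k} \<and>
      edges (attach G2 e2 Inr Inr N B) = copy_edges (\<lambda>w. length w < Suc k)"
    by (simp_all only: attach_simps assms UN_glue1 UN_glue2 UN_copy_edges1 UN_copy_edges2 copy_edges_Un simp_thms)
qed

lemma sfree_stage_eq:
  "verts (sfree_stage G1 e1 G2 e2 m) = {w. word w \<and> length w \<le> Suc m} \<and>
   edges (sfree_stage G1 e1 G2 e2 m) = copy_edges (\<lambda>w. length w < Suc m)"
proof (induction m rule: induct_nat_012)
  case 0
  show ?case
    using sfree_stage_0 by (simp only: less_Suc_eq_le)
next
  case 1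
  let ?B = "sfree_stage G1 e1 G2 e2 0"
  have "verts ?B - {[]} = {w. word w \<and> length w = Suc 0}"
    unfolding sfree_stage_0[THEN conjunct1] by (auto simp: le_Suc_eq)
  then show ?case
    using sfree_stage_step(2)[of ?B "Suc 0" "verts ?B - {[]}"] sfree_stage_0
    by (simp only: sfree_stage.simps(2) Let_def less_Suc_eq_le) simp
next
  case (ge2 m)
  let ?S = "sfree_stage G1 e1 G2 e2"
  \<comment> \<open>The newest vertices of stage \<open>Suc m\<close> have length m + 2, so the test
    \<open>even m\<close> in the definition is the parity of their level.\<close>
  have N: "verts (?S (Suc m)) - verts (?S m) = {w. word w \<and> length w = Suc (Suc m)}"
    using ge2 by auto
  show ?case
    using sfree_stage_step[of "?S (Suc m)" "Suc (Suc m)", OF _ _ N] ge2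
    by (simp only: sfree_stage.simps(3) Let_def split: if_split) simp
qed

lemma verts_P: "verts P = {w. word w}"
proof -
  have "verts P = (\<Union>m. {w. word w \<and> length w \<le> Suc m})"
    by (simp add: sfree_loop_product_def sfree_product_def Let_def sfree_stage_eq)
  also have "\<dots> = {w. word w}"
    by (auto intro: le_SucI)
  finally show ?thesis .
qed

lemma edges_P: "edges P = insert None (Some ` copy_edges (\<lambda>w. True))"
proof -
  have "edges P = insert None (Some ` (\<Union>m. copy_edges (\<lambda>w. length w < Suc m)))"
    by (simp add: sfree_loop_product_def sfree_product_def Let_def sfree_stage_eq)
  also have "(\<Union>m. copy_edges (\<lambda>w. length w < Suc m)) = copy_edges (\<lambda>w. True)"
    by (auto simp: copy_edges_def)
  finally show ?thesis .
qed

lemma ends_P [simp]: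
  "ends P None = Upair [] []"
  "ends P (Some (w, Inl b)) = map_uprod (glue e1 Inl w) (ends G1 b)"
  "ends P (Some (w, Inr b')) = map_uprod (glue e2 Inr w) (ends G2 b')"
  by (simp_all add: sfree_loop_product_def sfree_product_def sfree_ends_def Let_def)

lemma color_P [simp]:
  "color P None = 2" "color P (Some (w, Inl b)) = 1" "color P (Some (w, Inr b')) = 2"
  by (simp_all add: sfree_loop_product_def sfree_product_def Let_def)

lemma color_P_cases: "color P b = 1 \<or> color P b = 2"
proof (cases b)
  case (Some p)
  then show ?thesis
    by (cases p; cases "snd p") auto
qed simp

lemma edges_C1: "b \<in> edges C1 \<longleftrightarrow> (\<exists>w b'. b = Some (w, Inl b') \<and> word w \<and> even (length w) \<and> b' \<in> edges G1)"
  by (auto simp: C1_def edges_P copy_edges_def)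

lemma edges_C2:
  "b \<in> edges C2 \<longleftrightarrow> b = None \<or> (\<exists>w b'. b = Some (w, Inr b') \<and> word w \<and> odd (length w) \<and> b' \<in> edges G2)"
  by (auto simp: C2_def edges_P copy_edges_def)

section \<open>Neighbours inside a copy\<close>

lemma incident_C1:
  assumes "even (length w)" and "word w"
  shows "incident C1 (glue e1 Inl w v) = (\<lambda>b. Some (w, Inl b)) ` incident G1 v"
  using assms
  by (auto simp: incident_def edges_C1 uprod.set_map glue_eq_iff image_iff)

lemma incident_C2:
  assumes "odd (length w)" and "word w"
  shows "incident C2 (glue e2 Inr w v) = (\<lambda>b. Some (w, Inr b)) ` incident G2 v"
  using assms glue_nonempty[OF assms(1), of e2 Inr v]
  by (auto simp: incident_def edges_C2 uprod.set_map glue_eq_iff image_iff)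

text \<open>Copies of the second graph are attached at words of odd length and therefore avoid the
  empty word; what remains is the added loop.\<close>

lemma incident_C2_root: "incident C2 [] = {None}"
  by (auto simp: incident_def edges_C2 uprod.set_map glue_nonempty[symmetric])

lemma opposite_P_root [simp]: "opposite P [] None = []"
  by (rule opposite_eq) simp

lemma opposite_C1:
  assumes "b \<in> incident G1 v"
  shows "opposite P (glue e1 Inl w v) (Some (w, Inl b)) = glue e1 Inl w (opposite G1 v b)"
  by (rule opposite_eq) (simp add: ends_opposite[OF assms])

lemma opposite_C2:
  assumes "b \<in> incident G2 v"
  shows "opposite P (glue e2 Inr w v) (Some (w, Inr b)) = glue e2 Inr w (opposite G2 v b)"
  by (rule opposite_eq) (simp add: ends_opposite[OF assms])

lemma nbr_sum_C1:
  assumes "even (length w)" and "word w"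
  shows "nbr_sum C1 g (glue e1 Inl w v) = nbr_sum G1 (\<lambda>y. g (glue e1 Inl w y)) v"
  unfolding nbr_sum_def incident_C1[OF assms]
  by (subst sum.reindex) (auto simp: inj_on_def opposite_C1 intro!: sum.cong)

lemma nbr_sum_C2:
  assumes "odd (length w)" and "word w"
  shows "nbr_sum C2 g (glue e2 Inr w v) = nbr_sum G2 (\<lambda>y. g (glue e2 Inr w y)) v"
  unfolding nbr_sum_def incident_C2[OF assms]
  by (subst sum.reindex) (auto simp: inj_on_def opposite_C2 intro!: sum.cong)

lemma nbr_sum_C2_root: "nbr_sum C2 g [] = g []"
  by (simp add: nbr_sum_def incident_C2_root)

lemma ends_P_subset: "b \<in> edges P \<Longrightarrow> set_uprod (ends P b) \<subseteq> verts P"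
  using bounded_degree12
  by (auto simp: edges_P copy_edges_def verts_P uprod.set_map word_glue1 word_glue2 bounded_degree_def subset_iff)

lemma bounded_degree_C1: "bounded_degree C1"
proof -
  obtain d where d: "\<And>x. x \<in> verts G1 \<Longrightarrow> card (incident G1 x) \<le> d"
    using bounded_degree12(1) by (auto simp: bounded_degree_def uniformly_locally_finite_iff)
  have "finite (incident C1 x) \<and> card (incident C1 x) \<le> d" if x: "word x" for x
  proof -
    obtain w v where "even (length w)" "word w" "v \<in> verts G1" "x = glue e1 Inl w v"
      by (rule word_cases1[OF x])
    then show ?thesis
      using d[of v] by (simp add: incident_C1 finite_incident[OF bounded_degree12(1)] card_image inj_on_def)
  qed
  then show ?thesis
    using ends_P_subset unfolding bounded_degree_def uniformly_locally_finite_iff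
    by (auto simp: verts_P C1_def)
qed

lemma bounded_degree_C2: "bounded_degree C2"
proof -
  obtain d where d: "\<And>x. x \<in> verts G2 \<Longrightarrow> card (incident G2 x) \<le> d"
    using bounded_degree12(2) by (auto simp: bounded_degree_def uniformly_locally_finite_iff)
  have "finite (incident C2 x) \<and> card (incident C2 x) \<le> max d 1" if x: "word x" for x
  proof (cases "x = []")
    case False
    then obtain w v where "odd (length w)" "word w" "v \<in> verts G2" "x = glue e2 Inr w v"
      by (rule word_cases2[OF x])
    then show ?thesis
      using d[of v] by (simp add: incident_C2 finite_incident[OF bounded_degree12(2)] card_image inj_on_def)
  qed (simp add: incident_C2_root)
  then show ?thesis
    using ends_P_subset unfolding bounded_degree_def uniformly_locally_finite_iff
    by (auto simp: verts_P C2_def)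
qed

lemma incident_P: "incident P x = incident C1 x \<union> incident C2 x"
  using color_P_cases by (auto simp: C1_def C2_def incident_color_subgraph)

lemma bounded_degree_P: "bounded_degree P"
proof -
  obtain d1 where d1: "\<forall>x\<in>verts P. card (incident C1 x) \<le> d1"
    using bounded_degree_C1 by (auto simp: bounded_degree_def uniformly_locally_finite_iff)
  obtain d2 where d2: "\<forall>x\<in>verts P. card (incident C2 x) \<le> d2"
    using bounded_degree_C2 by (auto simp: bounded_degree_def uniformly_locally_finite_iff)
  have "finite (incident P x) \<and> card (incident P x) \<le> d1 + d2" if "x \<in> verts P" for x
    using d1 d2 that card_Un_le[of "incident C1 x" "incident C2 x"]
      finite_incident[OF bounded_degree_C1] finite_incident[OF bounded_degree_C2]
    by (force simp: incident_P)
  then show ?thesis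
    using ends_P_subset unfolding bounded_degree_def uniformly_locally_finite_iff by auto
qed

lemma nbr_sum_P: "nbr_sum P g x = nbr_sum C1 g x + nbr_sum C2 g x"
proof -
  have "incident C1 x \<inter> incident C2 x = {}"
    by (auto simp: C1_def C2_def incident_color_subgraph)
  then show ?thesis
    using finite_incident[OF bounded_degree_C1] finite_incident[OF bounded_degree_C2]
    by (simp add: nbr_sum_def incident_P sum.union_disjoint)
qed

lemma adjacency_op_P:
  "adjacency_op P = adjacency_op C1 \<oplus>\<^bsub>op_algebra (verts P)\<^esub> adjacency_op C2"
proof -
  have "adjacency_op P f y = adjacency_op C1 f y + adjacency_op C2 f y" for f y
    using adjacency_op_eq[OF bounded_degree_P, of f] adjacency_op_eq[OF bounded_degree_C1, of f]
      adjacency_op_eq[OF bounded_degree_C2, of f]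
    by (cases "f \<in> ell2 (verts P)") (auto simp: nbr_sum_P adjacency_op_def[of _ f])
  then show ?thesis
    by (simp add: op_algebra_simps fun_eq_iff)
qed

end

section \<open>Generating functions of alternating walks\<close>

text \<open>Substituting \<open>d\<close> for the variable lets every intermediate vertex of a
  hitting walk carry an excursion counted by \<open>d\<close>.\<close>

lemma hit_series_compose:
  assumes "fps_nth d 0 = 0"
  shows "hit_series G r v oo d = nbr_sum G (\<lambda>y. if y = r then 1 else d * (hit_series G r y oo d)) v"
proof -
  have "(if y = r then 1 else fps_X * hit_series G r y) oo d =
      (if y = r then 1 else d * (hit_series G r y oo d))" for y
    by (simp add: fps_compose_mult_distrib[OF assms] fps_X_fps_compose_startby0[OF assms])
  then show ?thesis
    by (subst hit_series_eq) (simp only: nbr_sum_def fps_compose_sum_distrib)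
qed

context rooted_graph_pair
begin

abbreviation D1 where "D1 \<equiv> sfree_eta (spectral_distribution G1 e1) (spectral_distribution G2 e2)"
abbreviation D2 where "D2 \<equiv> sfree_eta (spectral_distribution G2 e2) (spectral_distribution G1 e1)"

lemma D1_eq: "D1 = fps_X * (hit_series G1 e1 e1 oo D2)"
  and D2_eq: "D2 = fps_X * (hit_series G2 e2 e2 oo D1)"
  using sfree_eta_eq rho_series_spectral_distribution(2)[OF rooted1]
    rho_series_spectral_distribution(2)[OF rooted2] by metis+

text \<open>In \<open>walk_series1 x\<close> and \<open>walk_series2 x\<close> the variable marks the edges of color 1. They count the
  alternating walks from \<open>x\<close> that end at their first visit to the root and start with color 1
  and 2, respectively; such a walk consumes the letters of \<open>x\<close> one by one, which makes the series
  multiplicative. At the root, \<open>walk_series2\<close> takes the empty walk instead.\<close>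

primrec weight :: "('a + 'b) list \<Rightarrow> complex fps" where
  "weight [] = 1"
| "weight (a # w) = (case a of Inl v \<Rightarrow> fps_X * (hit_series G1 e1 v oo D2)
     | Inr v \<Rightarrow> hit_series G2 e2 v oo D1) * weight w"

definition walk_series1 :: "('a + 'b) list \<Rightarrow> complex fps" where
  "walk_series1 x = (if even (length x) then D1 * weight x else weight x)"

definition walk_series2 :: "('a + 'b) list \<Rightarrow> complex fps" where
  "walk_series2 x = (if odd (length x) then (hit_series G2 e2 e2 oo D1) * weight x else weight x)"

lemma walk_series_root: "walk_series1 [] = D1" "walk_series2 [] = 1"
  by (simp_all add: walk_series1_def walk_series2_def)

text \<open>Crossing a copy of the first graph with k intermediate vertices takes k + 1 edges of
  color 1 and k excursions of color 2, each counted by \<open>hit_series G2 e2 e2 oo D1\<close>.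
  Pairing every excursion with one edge gives the k-th power of \<open>D2\<close> and leaves a
  single factor \<open>fps_X\<close>.\<close>

lemma walk_series_glue1:
  assumes "even (length w)"
  shows "walk_series1 (glue e1 Inl w v) = fps_X * (hit_series G1 e1 v oo D2) * weight w"
    and "walk_series2 (glue e1 Inl w v) = (if v = e1 then 1 else D2 * (hit_series G1 e1 v oo D2)) * weight w"
proof -
  show "walk_series1 (glue e1 Inl w v) = fps_X * (hit_series G1 e1 v oo D2) * weight w"
    using assms D1_eq by (simp add: walk_series1_def glue_def)
  have "walk_series2 (glue e1 Inl w v) =
      (if v = e1 then 1 else (fps_X * (hit_series G2 e2 e2 oo D1)) * (hit_series G1 e1 v oo D2)) * weight w"
    using assms by (simp add: walk_series2_def glue_def mult_ac)
  then show "walk_series2 (glue e1 Inl w v) = (if v = e1 then 1 else D2 * (hit_series G1 e1 v oo D2)) * weight w"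
    by (simp only: D2_eq[symmetric])
qed

text \<open>Edges of color 2 have weight 1, so a crossing of a copy of the second graph contributes
  one factor \<open>D1\<close> per intermediate vertex and no extra \<open>fps_X\<close>.\<close>

lemma walk_series_glue2:
  assumes "odd (length w)"
  shows "walk_series2 (glue e2 Inr w v) = (hit_series G2 e2 v oo D1) * weight w"
    and "walk_series1 (glue e2 Inr w v) = (if v = e2 then 1 else D1 * (hit_series G2 e2 v oo D1)) * weight w"
  using assms by (simp_all add: walk_series1_def walk_series2_def glue_def mult.assoc)

text \<open>Within the copy containing \<open>x\<close> the factor \<open>weight w\<close> is common
  to all terms; what remains is \<open>hit_series_compose\<close> with
  \<open>d = D2\<close>.\<close>

lemma walk_series1_rec:
  assumes "word x"
  shows "walk_series1 x = fps_X * nbr_sum C1 walk_series2 x"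
proof -
  obtain w v where w: "even (length w)" "word w" "x = glue e1 Inl w v"
    using word_cases1[OF assms] by metis
  have "nbr_sum C1 walk_series2 x = (hit_series G1 e1 v oo D2) * weight w"
    unfolding w(3) nbr_sum_C1[OF w(1,2)] walk_series_glue1(2)[OF w(1)] nbr_sum_mult_right
    by (simp only: hit_series_compose[OF sfree_eta_nth_0, symmetric])
  then show ?thesis
    by (simp add: w(3) walk_series_glue1(1)[OF w(1)] mult.assoc)
qed

lemma walk_series2_rec:
  assumes "word x" and "x \<noteq> []"
  shows "walk_series2 x = nbr_sum C2 walk_series1 x"
proof -
  obtain w v where w: "odd (length w)" "word w" "x = glue e2 Inr w v"
    using word_cases2[OF assms] by metis
  show ?thesis
    unfolding w(3) nbr_sum_C2[OF w(1,2)] walk_series_glue2[OF w(1)] nbr_sum_mult_right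
    by (simp only: hit_series_compose[OF sfree_eta_nth_0, symmetric])
qed

lemma word_opposite_C1: "b \<in> incident C1 x \<Longrightarrow> word (opposite P x b)"
  using bounded_degree_opposite[OF bounded_degree_C1, of b x] by (simp add: verts_P)

lemma word_opposite_C2: "b \<in> incident C2 x \<Longrightarrow> word (opposite P x b)"
  using bounded_degree_opposite[OF bounded_degree_C2, of b x] by (simp add: verts_P)

lemma walk_series1_nth_0: "word x \<Longrightarrow> fps_nth (walk_series1 x) 0 = 0"
  by (simp add: walk_series1_rec)

lemma walk_series2_nth_0: "word x \<Longrightarrow> x \<noteq> [] \<Longrightarrow> fps_nth (walk_series2 x) 0 = 0"
  by (simp add: walk_series2_rec nbr_sum_def fps_sum_nth walk_series1_nth_0 word_opposite_C2)

section \<open>Powers of \<open>R2 R1\<close> on the delta function of the root\<close>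

abbreviation M where "M \<equiv> op_algebra (verts P)"
abbreviation \<phi> where "\<phi> \<equiv> vector_state (verts P) (delta [])"
abbreviation R1 where "R1 \<equiv> adjacency_op C1"
abbreviation R2 where "R2 \<equiv> adjacency_op C2"

lemma R1_bounded: "R1 \<in> bounded_ops (verts P)"
  using adjacency_op_bounded[OF bounded_degree_C1] by simp

lemma R2_bounded: "R2 \<in> bounded_ops (verts P)"
  using adjacency_op_bounded[OF bounded_degree_C2] by simp

lemma R1_eq: "f \<in> ell2 (verts P) \<Longrightarrow> R1 f = (\<lambda>x. if word x then nbr_sum C1 f x else 0)"
  using adjacency_op_eq[OF bounded_degree_C1, of f] by (simp add: verts_P)

lemma R2_eq: "f \<in> ell2 (verts P) \<Longrightarrow> R2 f = (\<lambda>x. if word x then nbr_sum C2 f x else 0)"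
  using adjacency_op_eq[OF bounded_degree_C2, of f] by (simp add: verts_P)

lemma root_in_verts_P: "[] \<in> verts P"
  by (simp add: verts_P)

text \<open>\<open>R1\<close> turns \<open>walk_series2\<close> into \<open>walk_series1\<close>
  with a shift by one coefficient, and \<open>R2\<close> turns it back without a shift, except at
  the root, where the loop yields D1 instead of 1. With U = 1 / (1 - D1), the identity U = 1 + D1 *
  U repairs this difference.\<close>

lemma Z_power_delta:
  assumes "word x"
  shows "((R2 \<otimes>\<^bsub>M\<^esub> R1) [^]\<^bsub>M\<^esub> n) (delta []) x = fps_nth (walk_series2 x * inverse (1 - D1)) n"
proof -
  define Z where "Z = R2 \<otimes>\<^bsub>M\<^esub> R1"
  define U where "U = inverse (1 - D1)"
  have Z: "Z \<in> bounded_ops (verts P)"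
    by (simp add: Z_def op_algebra_simps bounded_ops_comp R1_bounded R2_bounded)
  have "(1 - D1) * U = 1"
    unfolding U_def by (rule inverse_mult_eq_1') simp
  then have U: "U = 1 + D1 * U"
    by (simp add: algebra_simps)
  have "(Z [^]\<^bsub>M\<^esub> n) (delta []) x = fps_nth (walk_series2 x * U) n"
    using assms
  proof (induction n arbitrary: x)
    case 0
    have "fps_nth U 0 = 1"
      by (simp add: U_def)
    moreover have "(Z [^]\<^bsub>M\<^esub> (0::nat)) (delta []) = delta []"
      by (simp add: op_algebra_simps delta_in_ell2 root_in_verts_P)
    ultimately show ?case
      using 0 walk_series2_nth_0[of x] by (cases "x = []") (simp_all add: delta_def walk_series_root)
  next
    case (Suc n)
    let ?f = "(Z [^]\<^bsub>M\<^esub> n) (delta [])"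
    have f: "?f \<in> ell2 (verts P)"
      by (rule op_algebra_pow_ell2[OF Z delta_in_ell2[OF root_in_verts_P]])
    have R1f: "R1 ?f y = fps_nth (walk_series1 y * U) (Suc n)" if "word y" for y
    proof -
      have "R1 ?f y = nbr_sum C1 (\<lambda>y. fps_nth (walk_series2 y * U) n) y"
        using that Suc.IH word_opposite_C1 by (simp add: R1_eq[OF f] nbr_sum_def)
      also have "\<dots> = fps_nth (nbr_sum C1 walk_series2 y * U) n"
        by (simp only: fps_nth_nbr_sum[symmetric] nbr_sum_mult_right)
      finally show ?thesis
        using that by (simp add: walk_series1_rec mult.assoc)
    qed
    have "(Z [^]\<^bsub>M\<^esub> Suc n) (delta []) x = R2 (R1 ?f) x"
      unfolding op_algebra_pow_Suc[OF Z] by (subst Z_def) (simp add: op_algebra_simps)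
    also have "\<dots> = nbr_sum C2 (\<lambda>y. fps_nth (walk_series1 y * U) (Suc n)) x"
      using Suc.prems R1f word_opposite_C2
      by (simp add: R2_eq[OF bounded_opsD(3)[OF R1_bounded]] nbr_sum_def)
    also have "\<dots> = fps_nth (nbr_sum C2 walk_series1 x * U) (Suc n)"
      by (simp only: fps_nth_nbr_sum[symmetric] nbr_sum_mult_right)
    also have "\<dots> = fps_nth (walk_series2 x * U) (Suc n)"
    proof (cases "x = []")
      case True
      have "fps_nth U (Suc n) = fps_nth (D1 * U) (Suc n)"
        using arg_cong[OF U, of "\<lambda>u. fps_nth u (Suc n)"] by simp
      then show ?thesis
        by (simp add: True nbr_sum_C2_root walk_series_root)
    qed (use Suc.prems walk_series2_rec in simp)
    finally show ?case .
  qed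
  then show ?thesis
    by (simp add: Z_def U_def)
qed

lemma eta_series_Z: "eta_series (distribution M \<phi> (R2 \<otimes>\<^bsub>M\<^esub> R1)) = D1"
proof (rule eta_seriesI)
  have "1 + psi_series (distribution M \<phi> (R2 \<otimes>\<^bsub>M\<^esub> R1)) = inverse (1 - D1)"
    using one_plus_psi_series_distribution[of \<phi> M "R2 \<otimes>\<^bsub>M\<^esub> R1", OF vector_state_delta_one[OF root_in_verts_P]]
    by (simp add: vector_state_delta root_in_verts_P Z_power_delta walk_series_root fps_nth_inverse)
  moreover have "(1 - D1) * inverse (1 - D1) = 1"
    by (rule inverse_mult_eq_1') simp
  ultimately show "1 + psi_series (distribution M \<phi> (R2 \<otimes>\<^bsub>M\<^esub> R1)) =
      1 + D1 * (1 + psi_series (distribution M \<phi> (R2 \<otimes>\<^bsub>M\<^esub> R1)))"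
    by (simp only:) (simp add: algebra_simps)
qed

text \<open>Length 0 gives no walk: arrival at the root is recorded together with the edge leading
  there, so \<open>x\<close> may itself be the root. The colors being 1 and 2, \<open>3 - c\<close>
  is the other one.\<close>

primrec hitting_walks :: "nat \<Rightarrow> nat \<Rightarrow> ('a + 'b) list \<Rightarrow>
    (('a + 'b) list, (('a + 'b) list \<times> ('c + 'd)) option) walk set" where
  "hitting_walks 0 c x = {}"
| "hitting_walks (Suc k) c x = (\<Union>b\<in>incident (color_subgraph P c) x. (\<lambda>(vs, bs). (x # vs, b # bs)) `
     (if opposite P x b = [] then (if k = 0 then {([[]], [])} else {})
      else hitting_walks k (3 - c) (opposite P x b)))"

lemma finite_incident_color: "finite (incident (color_subgraph P c) x)"
  using finite_incident[OF bounded_degree_P] by (simp add: incident_color_subgraph)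

lemma finite_hitting_walks: "finite (hitting_walks k c x)"
  by (induction k arbitrary: c x) (simp_all add: finite_incident_color)

lemma card_hitting_walks_Suc:
  "card (hitting_walks (Suc k) c x) = nbr_sum (color_subgraph P c)
     (\<lambda>y. if y = [] then of_bool (k = 0) else card (hitting_walks k (3 - c) y)) x"
proof -
  let ?f = "\<lambda>b. \<lambda>(vs, bs). (x # vs, b # bs)"
  let ?S = "\<lambda>y. if y = [] then (if k = 0 then {([[]], [])} else {}) else hitting_walks k (3 - c) y"
  have "card (hitting_walks (Suc k) c x) =
      (\<Sum>b\<in>incident (color_subgraph P c) x. card (?f b ` ?S (opposite P x b)))"
    unfolding hitting_walks.simps
    by (rule card_UN_disjoint) (auto simp: finite_incident_color finite_hitting_walks)
  also have "\<dots> = (\<Sum>b\<in>incident (color_subgraph P c) x. card (?S (opposite P x b)))"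
    by (intro sum.cong refl card_image) (auto simp: inj_on_def)
  finally show ?thesis
    by (auto simp: nbr_sum_def intro!: sum.cong)
qed

lemma of_nat_nbr_sum: "of_nat (nbr_sum G g x) = nbr_sum G (\<lambda>y. of_nat (g y)) x"
  by (simp add: nbr_sum_def)

text \<open>The count for color 2 enters as a hypothesis, so that the lemma can be used inside the
  induction of \<open>card_hitting_walks2\<close> and again at the root. The n + 1 on the right is
  the number of edges of color 1 among the 2n + 1.\<close>

lemma card_hitting_walks1:
  assumes "word x"
    and "\<And>y. word y \<Longrightarrow> y \<noteq> [] \<Longrightarrow> of_nat (card (hitting_walks (2 * n) 2 y)) = fps_nth (walk_series2 y) n"
  shows "of_nat (card (hitting_walks (Suc (2 * n)) 1 x)) = fps_nth (walk_series1 x) (Suc n)"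
proof -
  have "complex_of_nat (card (hitting_walks (Suc (2 * n)) 1 x)) =
      nbr_sum C1 (\<lambda>y. of_nat (if y = [] then of_bool (2 * n = 0) else card (hitting_walks (2 * n) 2 y))) x"
  proof -
    have "(3::nat) - 1 = 2"
      by simp
    then show ?thesis
      by (simp only: card_hitting_walks_Suc of_nat_nbr_sum C1_def)
  qed
  also have "\<dots> = nbr_sum C1 (\<lambda>y. fps_nth (walk_series2 y) n) x"
  proof (rule nbr_sum_cong)
    fix b assume "b \<in> incident C1 x"
    then show "of_nat (if opposite C1 x b = [] then of_bool (2 * n = 0)
        else card (hitting_walks (2 * n) 2 (opposite C1 x b))) = fps_nth (walk_series2 (opposite C1 x b)) n"
      using assms(2)[OF word_opposite_C1] by (auto simp: walk_series_root)
  qed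
  finally show ?thesis
    using assms(1) by (simp add: walk_series1_rec fps_nth_nbr_sum)
qed

lemma card_hitting_walks2:
  assumes "word x" and "x \<noteq> []"
  shows "of_nat (card (hitting_walks (2 * n) 2 x)) = fps_nth (walk_series2 x) n"
  using assms
proof (induction n arbitrary: x)
  case 0
  then show ?case
    by (simp add: walk_series2_nth_0)
next
  case (Suc n)
  \<comment> \<open>An edge of color 2 meets the root only as the loop, so from
    \<open>x \<noteq> []\<close> the first edge never ends the walk.\<close>
  have ne: "opposite P x b \<noteq> []" if "b \<in> incident C2 x" for b
  proof
    assume "opposite P x b = []"
    then have "b \<in> incident C2 []" "opposite P [] b = x"
      using incident_opposite[OF that] by simp_all
    then show False
      using Suc.prems(2) by (simp add: incident_C2_root)
  qed
  have "complex_of_nat (card (hitting_walks (2 * Suc n) 2 x)) =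
      nbr_sum C2 (\<lambda>y. of_nat (if y = [] then of_bool (Suc (2 * n) = 0) else card (hitting_walks (Suc (2 * n)) 1 y))) x"
  proof -
    have "(3::nat) - 2 = 1"
      by simp
    then show ?thesis
      by (simp only: card_hitting_walks_Suc of_nat_nbr_sum C2_def mult_Suc_right add_2_eq_Suc)
  qed
  also have "\<dots> = nbr_sum C2 (\<lambda>y. fps_nth (walk_series1 y) (Suc n)) x"
  proof (rule nbr_sum_cong)
    fix b assume b: "b \<in> incident C2 x"
    show "of_nat (if opposite C2 x b = [] then of_bool (Suc (2 * n) = 0)
        else card (hitting_walks (Suc (2 * n)) 1 (opposite C2 x b))) =
        fps_nth (walk_series1 (opposite C2 x b)) (Suc n)"
      using ne[OF b] card_hitting_walks1[OF word_opposite_C2[OF b] Suc.IH] by simp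
  qed
  finally show ?case
    using Suc.prems by (simp add: walk_series2_rec fps_nth_nbr_sum)
qed

lemma card_hitting_walks_root: "of_nat (card (hitting_walks (Suc (2 * n)) 1 [])) = fps_nth D1 (Suc n)"
  using card_hitting_walks1[OF _ card_hitting_walks2, of "[]" n] by (simp add: walk_series_root)

section \<open>Rooted alternating d-walks\<close>

text \<open>Declarative form of \<open>hitting_walks\<close>, with the starting vertex left open so
  that tails keep this form; membership of the vertices in the graph is recovered from the edges in
  \<open>hitting_eq_f_walk\<close>.\<close>

definition hitting :: "nat \<Rightarrow> ('a + 'b) list list \<Rightarrow> (('a + 'b) list \<times> ('c + 'd)) option list \<Rightarrow> bool" where
  "hitting c vs bs \<longleftrightarrow> length vs = Suc (length bs) \<and> bs \<noteq> [] \<and> last vs = [] \<and>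
     (\<forall>i<length bs. joins P (bs ! i) (vs ! i) (vs ! Suc i)) \<and>
     (\<forall>i. 1 \<le> i \<and> i < length bs \<longrightarrow> vs ! i \<noteq> []) \<and>
     successively (\<noteq>) (map (color P) bs) \<and> color P (hd bs) = c"

lemma hitting_Cons_Nil: "hitting c (x # vs) [b] \<longleftrightarrow> vs = [[]] \<and> joins P b x [] \<and> color P b = c"
  by (cases vs) (auto simp: hitting_def)

lemma hitting_Cons_Cons:
  assumes "c = 1 \<or> c = 2"
  shows "hitting c (x # y # vs) (b # b' # bs) \<longleftrightarrow>
    joins P b x y \<and> color P b = c \<and> y \<noteq> [] \<and> hitting (3 - c) (y # vs) (b' # bs)"
proof -
  have inner: "(\<forall>i. 1 \<le> i \<and> i < length (b # b' # bs) \<longrightarrow> (x # y # vs) ! i \<noteq> []) \<longleftrightarrow>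
      y \<noteq> [] \<and> (\<forall>i. 1 \<le> i \<and> i < length (b' # bs) \<longrightarrow> (y # vs) ! i \<noteq> [])"
    (is "?l \<longleftrightarrow> ?r")
  proof
    assume l: ?l
    show ?r
    proof (intro conjI allI impI)
      show "y \<noteq> []"
        using l[rule_format, of 1] by simp
      fix i assume "1 \<le> i \<and> i < length (b' # bs)"
      then show "(y # vs) ! i \<noteq> []"
        using l[rule_format, of "Suc i"] by simp
    qed
  next
    assume r: ?r
    show ?l
    proof (intro allI impI)
      fix i assume "1 \<le> i \<and> i < length (b # b' # bs)"
      then show "(x # y # vs) ! i \<noteq> []"
        using r by (cases i; cases "i = 1") auto
    qed
  qed
  have joins: "(\<forall>i<length (b # b' # bs). joins P ((b # b' # bs) ! i) ((x # y # vs) ! i) ((x # y # vs) ! Suc i)) \<longleftrightarrow>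
      joins P b x y \<and> (\<forall>i<length (b' # bs). joins P ((b' # bs) ! i) ((y # vs) ! i) ((y # vs) ! Suc i))"
    unfolding length_Cons by (subst All_less_Suc2) (simp only: nth_Cons_0 nth_Cons_Suc)
  have len: "length (x # y # vs) = Suc (length (b # b' # bs)) \<longleftrightarrow> length (y # vs) = Suc (length (b' # bs))"
    and last: "last (x # y # vs) = last (y # vs)"
    and alt: "successively (\<noteq>) (map (color P) (b # b' # bs)) \<longleftrightarrow>
      color P b \<noteq> color P b' \<and> successively (\<noteq>) (map (color P) (b' # bs))"
    by simp_all
  have "color P b = c \<and> color P b \<noteq> color P b' \<longleftrightarrow> color P b = c \<and> color P b' = 3 - c"
    using assms color_P_cases[of b'] by auto
  then show ?thesis
    unfolding hitting_def inner joins len last alt list.sel by blast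
qed

lemma Cons_mem_UN:
  "(x # vs, b # bs) \<in> (\<Union>b\<in>I. (\<lambda>(vs, bs). (x # vs, b # bs)) ` S b) \<longleftrightarrow> b \<in> I \<and> (vs, bs) \<in> S b"
proof
  assume "b \<in> I \<and> (vs, bs) \<in> S b"
  then show "(x # vs, b # bs) \<in> (\<Union>b\<in>I. (\<lambda>(vs, bs). (x # vs, b # bs)) ` S b)"
    by (intro UN_I[of b] image_eqI[of _ _ "(vs, bs)"]) auto
qed auto

lemma hitting_walks_iff:
  assumes "c = 1 \<or> c = 2"
  shows "(vs, bs) \<in> hitting_walks k c x \<longleftrightarrow> length bs = k \<and> vs \<noteq> [] \<and> hd vs = x \<and> hitting c vs bs"
  using assms
proof (induction k arbitrary: c x vs bs)
  case 0
  then show ?case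
    by (auto simp: hitting_def)
next
  case (Suc k)
  have c: "3 - c = 1 \<or> 3 - c = 2"
    using Suc.prems by auto
  show ?case
  proof (cases "\<exists>b bs' vs'. bs = b # bs' \<and> vs = x # vs'")
    case False
    then have "(vs, bs) \<notin> hitting_walks (Suc k) c x"
      by auto
    moreover have "\<not> (length bs = Suc k \<and> vs \<noteq> [] \<and> hd vs = x)"
      using False by (cases vs; cases bs) auto
    ultimately show ?thesis
      by blast
  next
    case True
    then obtain b bs' vs' where eq: "bs = b # bs'" "vs = x # vs'"
      by blast
    let ?y = "opposite P x b"
    have joins: "joins P b x z \<and> color P b = c \<longleftrightarrow> b \<in> incident (color_subgraph P c) x \<and> ?y = z" for z
      by (auto simp: incident_color_subgraph joins_iff)
    have mem: "(vs, bs) \<in> hitting_walks (Suc k) c x \<longleftrightarrow> b \<in> incident (color_subgraph P c) x \<and>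
        (if ?y = [] then k = 0 \<and> vs' = [[]] \<and> bs' = []
         else length bs' = k \<and> vs' \<noteq> [] \<and> hd vs' = ?y \<and> hitting (3 - c) vs' bs')"
    proof -
      have "(vs, bs) \<in> hitting_walks (Suc k) c x \<longleftrightarrow> b \<in> incident (color_subgraph P c) x \<and>
          (vs', bs') \<in> (if ?y = [] then (if k = 0 then {([[]], [])} else {}) else hitting_walks k (3 - c) ?y)"
        unfolding eq hitting_walks.simps Cons_mem_UN ..
      then show ?thesis
        by (cases "?y = []") (simp_all add: Suc.IH[OF c])
    qed
    show ?thesis
    proof (cases bs')
      case Nil
      have "hitting c vs bs \<longleftrightarrow> vs' = [[]] \<and> b \<in> incident (color_subgraph P c) x \<and> ?y = []"
        unfolding eq Nil hitting_Cons_Nil joins by blast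
      moreover have "\<not> hitting (3 - c) vs' bs'"
        by (simp add: Nil hitting_def)
      ultimately show ?thesis
        unfolding mem by (auto simp: eq Nil)
    next
      case (Cons b' bs'')
      show ?thesis
      proof (cases vs')
        case Nil
        then show ?thesis
          unfolding mem by (simp add: eq hitting_def)
      next
        case Cons': (Cons z vs'')
        have "hitting c vs bs \<longleftrightarrow> (b \<in> incident (color_subgraph P c) x \<and> ?y = z) \<and> z \<noteq> [] \<and> hitting (3 - c) vs' bs'"
          unfolding joins[symmetric] eq Cons Cons' hitting_Cons_Cons[OF Suc.prems] by blast
        then show ?thesis
          unfolding mem by (auto simp: eq Cons Cons')
      qed
    qed
  qed
qed

lemma hitting_eq_f_walk:
  "vs \<noteq> [] \<and> hd vs = [] \<and> hitting c vs bs \<longleftrightarrow>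
    f_walk P [] (vs, bs) \<and> alternating P (vs, bs) \<and> color P (hd bs) = c"
proof -
  have "set vs \<subseteq> verts P"
    if len: "length vs = Suc (length bs)" and "bs \<noteq> []"
      and joins: "\<forall>i<length bs. joins P (bs ! i) (vs ! i) (vs ! Suc i)"
  proof
    fix x assume "x \<in> set vs"
    then obtain i where i: "i < Suc (length bs)" "vs ! i = x"
      using len by (auto simp: in_set_conv_nth)
    have verts: "u \<in> verts P \<and> v \<in> verts P" if "joins P b u v" for b u v
      using that ends_P_subset[of b] by (auto simp: joins_def)
    show "x \<in> verts P"
    proof (cases i)
      case 0
      then show ?thesis
        using verts[OF joins[rule_format, of 0]] \<open>bs \<noteq> []\<close> i by auto
    next
      case (Suc j)
      then show ?thesis
        using verts[OF joins[rule_format, of j]] i by auto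
    qed
  qed
  then show ?thesis
    unfolding hitting_def f_walk_def alternating_def walk_from_to_def is_walk_def walk_length_def
    by (auto simp: Suc_le_eq)
qed

lemma hitting_walks_root:
  "c = 1 \<or> c = 2 \<Longrightarrow> w \<in> hitting_walks k c [] \<longleftrightarrow>
    f_walk P [] w \<and> alternating P w \<and> color P (hd (snd w)) = c \<and> walk_length w = k"
  using hitting_walks_iff[of c "fst w" "snd w" k "[]"] hitting_eq_f_walk[of "fst w" c "snd w"]
  by (auto simp: walk_length_def)

lemma joins_root_color2: "joins P b [] x \<Longrightarrow> color P b = 2 \<Longrightarrow> b = None \<and> x = []"
proof -
  assume "joins P b [] x" "color P b = 2"
  then have "b \<in> incident C2 []" "opposite P [] b = x"
    by (simp_all add: joins_iff C2_def incident_color_subgraph)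
  then show "b = None \<and> x = []"
    by (auto simp: incident_C2_root)
qed

text \<open>An edge of color 2 leaving or entering the root is the loop. Then the adjacent position
  of the walk is the root as well, which an f-walk allows only in length 1.\<close>

lemma f_walk_color2:
  assumes f: "f_walk P [] w" and "color P (hd (snd w)) = 2 \<or> color P (last (snd w)) = 2"
  shows "w = ([[], []], [None])"
proof -
  obtain vs bs where w: "w = (vs, bs)"
    by fastforce
  have len: "length vs = Suc (length bs)" and bs: "bs \<noteq> []"
    and joins: "\<And>i. i < length bs \<Longrightarrow> joins P (bs ! i) (vs ! i) (vs ! Suc i)"
    and ends: "hd vs = []" "last vs = []"
    and inner: "\<And>i. 1 \<le> i \<Longrightarrow> i < length bs \<Longrightarrow> vs ! i \<noteq> []"
    using f unfolding w f_walk_def walk_from_to_def is_walk_def walk_length_def by auto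
  have "vs \<noteq> []"
    using len by auto
  then have first: "vs ! 0 = []" and last: "vs ! length bs = []"
    using ends len by (simp_all add: hd_conv_nth last_conv_nth)
  have "length bs = 1"
    using assms(2)
  proof
    assume "color P (hd (snd w)) = 2"
    then have "vs ! 1 = []"
      using joins_root_color2[of "bs ! 0" "vs ! 1"] joins[of 0] bs first by (simp add: w hd_conv_nth)
    then show ?thesis
      using inner[of 1] bs by (cases "length bs") auto
  next
    assume "color P (last (snd w)) = 2"
    moreover have "joins P (bs ! (length bs - 1)) [] (vs ! (length bs - 1))"
      using joins[of "length bs - 1"] bs last joins_sym by (metis Suc_diff_1 diff_less length_greater_0_conv zero_less_one)
    ultimately have "vs ! (length bs - 1) = []"
      using joins_root_color2 bs by (simp add: w last_conv_nth)
    then show ?thesis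
      using inner[of "length bs - 1"] bs by (cases "length bs"; cases "length bs - 1") auto
  qed
  then obtain b u v where eq: "bs = [b]" "vs = [u, v]"
    using len by (auto simp: length_Suc_conv)
  then have "joins P b [] []"
    using joins[of 0] first last by simp
  then show ?thesis
    using joins_root_color2[of b "[]"] assms(2) first last by (auto simp: w eq)
qed

lemma f_walk_loop: "f_walk P [] ([[], []], [None])"
  by (auto simp: f_walk_def walk_from_to_def is_walk_def walk_length_def joins_def verts_P edges_P)

text \<open>The loop is the only edge of color 2 at the root, so the second f-walk of a rooted d-walk is the
  loop.\<close>

lemma D_walks_eq: "D_walks P (Suc k) [] = (\<lambda>w. walk_concat w ([[], []], [None])) ` hitting_walks k 1 []"
proof (intro equalityI subsetI)
  fix w assume "w \<in> D_walks P (Suc k) []"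
  then obtain w1 w2 where f: "f_walk P [] w1" "f_walk P [] w2" and w: "w = walk_concat w1 w2"
    and alt: "alternating P w" and color: "color P (hd (snd w)) = 1" and len: "walk_length w = Suc k"
    by (auto simp: D_walks_def alternating_d_walk_def)
  have ne: "snd w1 \<noteq> []" "snd w2 \<noteq> []"
    using f by (auto simp: f_walk_def walk_length_def)
  have hd1: "color P (hd (snd w1)) = 1"
    using color ne by (simp add: w walk_concat_def)
  \<comment> \<open>Ending with color 2 would make \<open>w1\<close> the loop, but it starts with
    color 1. Alternation then forces \<open>w2\<close> to start with color 2.\<close>
  then have "color P (last (snd w1)) \<noteq> 2"
    using f_walk_color2[OF f(1)] by auto
  then have "color P (last (snd w1)) = 1"
    using color_P_cases by blast
  moreover have alt1: "alternating P w1" and "color P (last (snd w1)) \<noteq> color P (hd (snd w2))"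
    using alt ne by (auto simp: w walk_concat_def alternating_def successively_append_iff last_map hd_map)
  ultimately have "color P (hd (snd w2)) = 2"
    using color_P_cases[of "hd (snd w2)"] by auto
  then have w2: "w2 = ([[], []], [None])"
    using f_walk_color2[OF f(2)] by blast
  then have "w1 \<in> hitting_walks k 1 []"
    using f alt1 hd1 len by (simp add: hitting_walks_root w walk_concat_def walk_length_def)
  then show "w \<in> (\<lambda>w. walk_concat w ([[], []], [None])) ` hitting_walks k 1 []"
    by (simp add: w w2)
next
  fix w assume "w \<in> (\<lambda>w. walk_concat w ([[], []], [None])) ` hitting_walks k 1 []"
  then obtain w1 where w: "w = walk_concat w1 ([[], []], [None])" and f: "f_walk P [] w1"
    and alt: "alternating P w1" and color: "color P (hd (snd w1)) = 1" and len: "walk_length w1 = k"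
    by (auto simp: hitting_walks_root)
  have ne: "snd w1 \<noteq> []"
    using f by (auto simp: f_walk_def walk_length_def)
  have "color P (last (snd w1)) \<noteq> 2"
    using f_walk_color2[OF f] color by auto
  then have "alternating P w"
    using alt ne by (simp add: w walk_concat_def alternating_def successively_append_iff last_map)
  moreover have "\<exists>w1 w2. f_walk P [] w1 \<and> f_walk P [] w2 \<and> w = walk_concat w1 w2"
    using f f_walk_loop w by blast
  moreover have "snd w \<noteq> []" "color P (hd (snd w)) = 1" "walk_length w = Suc k"
    using color len ne by (auto simp: w walk_concat_def walk_length_def)
  ultimately show "w \<in> D_walks P (Suc k) []"
    unfolding D_walks_def alternating_d_walk_def by blast
qed

lemma card_D_walks:
  assumes "n \<ge> 1"
  shows "finite (D_walks P (2 * n) [])" and "of_nat (card (D_walks P (2 * n) [])) = fps_nth D1 n"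
proof -
  obtain m where n: "n = Suc m"
    using assms by (cases n) auto
  \<comment> \<open>With n = m + 1, the first f-walk has 2m + 1 edges and the loop is the last
    one.\<close>
  have eq: "D_walks P (2 * n) [] = (\<lambda>w. walk_concat w ([[], []], [None])) ` hitting_walks (Suc (2 * m)) 1 []"
    using D_walks_eq[of "Suc (2 * m)"] by (simp only: n mult_Suc_right add_2_eq_Suc)
  show "finite (D_walks P (2 * n) [])"
    unfolding eq by (intro finite_imageI finite_hitting_walks)
  have "inj_on (\<lambda>w. walk_concat w ([[], []], [None])) (hitting_walks (Suc (2 * m)) 1 [])"
    by (auto simp: inj_on_def walk_concat_def)
  then have "card (D_walks P (2 * n) []) = card (hitting_walks (Suc (2 * m)) 1 [])"
    unfolding eq by (rule card_image)
  then show "of_nat (card (D_walks P (2 * n) [])) = fps_nth D1 n"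
    using card_hitting_walks_root[of m] by (simp only: n)
qed

end

section \<open>s-freeness\<close>

text \<open>Local maps act on arbitrary functions on a factor, without summability; the parity
  argument evaluates them on multiples of one delta function, and homogeneity pulls the scalar
  out.\<close>

definition homogeneous :: "(('v \<Rightarrow> complex) \<Rightarrow> ('v \<Rightarrow> complex)) \<Rightarrow> bool" where
  "homogeneous t \<longleftrightarrow> (\<forall>c f. t (\<lambda>x. c * f x) = (\<lambda>x. c * t f x))"

text \<open>\<open>g w\<close> embeds a fixed graph as its copy attached at \<open>w\<close>; the operator restricts to every copy
  and is given there by one and the same map.\<close>

definition acts_on_copies :: "'x set \<Rightarrow> 'w set \<Rightarrow> ('w \<Rightarrow> 'v \<Rightarrow> 'x) \<Rightarrow> (('x \<Rightarrow> complex) \<Rightarrow> ('x \<Rightarrow> complex)) set" where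
  "acts_on_copies V W g = {T \<in> bounded_ops V. \<exists>t. homogeneous t \<and>
     (\<forall>f\<in>ell2 V. \<forall>w\<in>W. (\<lambda>v. T f (g w v)) = t (\<lambda>v. f (g w v)))}"

lemma acts_on_copiesI:
  assumes "T \<in> bounded_ops V" and "homogeneous t"
    and "\<And>f w. f \<in> ell2 V \<Longrightarrow> w \<in> W \<Longrightarrow> (\<lambda>v. T f (g w v)) = t (\<lambda>v. f (g w v))"
  shows "T \<in> acts_on_copies V W g"
  using assms unfolding acts_on_copies_def by blast

lemma acts_on_copiesE:
  assumes "T \<in> acts_on_copies V W g"
  obtains t where "T \<in> bounded_ops V" and "homogeneous t"
    and "\<And>f w. f \<in> ell2 V \<Longrightarrow> w \<in> W \<Longrightarrow> (\<lambda>v. T f (g w v)) = t (\<lambda>v. f (g w v))"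
  using assms unfolding acts_on_copies_def by blast

lemma subalg_acts_on_copies: "subalg (op_algebra V) (acts_on_copies V W g)"
  unfolding subalg_def op_algebra_simps
proof (intro conjI ballI allI)
  show "acts_on_copies V W g \<subseteq> bounded_ops V"
    by (auto simp: acts_on_copies_def)
  show "(\<lambda>f x. 0) \<in> acts_on_copies V W g"
    by (rule acts_on_copiesI[where t = "\<lambda>f x. 0"]) (simp_all add: bounded_ops_zero homogeneous_def)
  fix S assume S: "S \<in> acts_on_copies V W g"
  obtain s where s: "S \<in> bounded_ops V" "homogeneous s"
    "\<And>f w. f \<in> ell2 V \<Longrightarrow> w \<in> W \<Longrightarrow> (\<lambda>v. S f (g w v)) = s (\<lambda>v. f (g w v))"
    by (rule acts_on_copiesE[OF S]) blast
  show "(\<lambda>f x. c * S f x) \<in> acts_on_copies V W g" for c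
  proof (rule acts_on_copiesI[where t = "\<lambda>f x. c * s f x"])
    fix f w assume "f \<in> ell2 V" "w \<in> W"
    from s(3)[OF this] show "(\<lambda>v. c * S f (g w v)) = (\<lambda>x. c * s (\<lambda>v. f (g w v)) x)"
      by (simp add: fun_eq_iff)
  qed (use s in \<open>auto simp: homogeneous_def bounded_ops_smult mult.left_commute\<close>)
  fix T assume T: "T \<in> acts_on_copies V W g"
  obtain t where t: "T \<in> bounded_ops V" "homogeneous t"
    "\<And>f w. f \<in> ell2 V \<Longrightarrow> w \<in> W \<Longrightarrow> (\<lambda>v. T f (g w v)) = t (\<lambda>v. f (g w v))"
    by (rule acts_on_copiesE[OF T]) blast
  show "(\<lambda>f x. S f x + T f x) \<in> acts_on_copies V W g"
  proof (rule acts_on_copiesI[where t = "\<lambda>f x. s f x + t f x"])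
    fix f w assume "f \<in> ell2 V" "w \<in> W"
    from s(3)[OF this] t(3)[OF this]
    show "(\<lambda>v. S f (g w v) + T f (g w v)) = (\<lambda>x. s (\<lambda>v. f (g w v)) x + t (\<lambda>v. f (g w v)) x)"
      by (simp add: fun_eq_iff)
  qed (use s t in \<open>auto simp: homogeneous_def bounded_ops_add distrib_left\<close>)
  show "S \<circ> T \<in> acts_on_copies V W g"
  proof (rule acts_on_copiesI[where t = "s \<circ> t"])
    fix f w assume f: "f \<in> ell2 V" and w: "w \<in> W"
    show "(\<lambda>v. (S \<circ> T) f (g w v)) = (s \<circ> t) (\<lambda>v. f (g w v))"
      using s(3)[OF bounded_opsD(3)[OF t(1)] w, of f] t(3)[OF f w] by simp
  qed (use s t in \<open>auto simp: homogeneous_def bounded_ops_comp\<close>)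
qed

lemma subalg_vanishing_at: "subalg (op_algebra V) {T \<in> bounded_ops V. \<forall>f\<in>ell2 V. T f x = 0}"
  unfolding subalg_def op_algebra_simps
  by (auto simp: bounded_ops_zero bounded_ops_add bounded_ops_comp bounded_ops_smult bounded_opsD(3))

lemma subalg_minus:
  assumes "subalg (op_algebra V) A" and "S \<in> A" and "T \<in> A"
  shows "S \<ominus>\<^bsub>op_algebra V\<^esub> T \<in> A"
proof -
  have "T \<in> bounded_ops V"
    using assms by (auto simp: subalg_def op_algebra_simps)
  then have "S \<ominus>\<^bsub>op_algebra V\<^esub> T = S \<oplus>\<^bsub>op_algebra V\<^esub> ((- 1) \<odot>\<^bsub>op_algebra V\<^esub> T)"
    by (simp add: op_algebra_minus op_algebra_simps)
  then show ?thesis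
    using assms by (simp add: subalg_def)
qed

lemma acts_on_copies_one: "\<one>\<^bsub>op_algebra V\<^esub> \<in> acts_on_copies V W g"
  unfolding op_algebra_simps
  by (rule acts_on_copiesI[where t = "\<lambda>f. f"]) (simp_all add: bounded_ops_one homogeneous_def)

lemma homogeneous_nbr_sum: "homogeneous (\<lambda>f v. if v \<in> A then nbr_sum G f v else 0)"
  by (simp add: homogeneous_def nbr_sum_mult_left fun_eq_iff)

lemma homogeneous_delta:
  assumes "homogeneous t"
  shows "t (\<lambda>v. if v = r then c else 0) r = c * t (delta r) r"
proof -
  have "(\<lambda>v. if v = r then c else 0) = (\<lambda>v. c * delta r v)"
    by (auto simp: delta_def)
  then show ?thesis
    using assms by (simp add: homogeneous_def)
qed

section \<open>The projection off the root\<close>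

definition proj_off :: "'x set \<Rightarrow> 'x \<Rightarrow> ('x \<Rightarrow> complex) \<Rightarrow> ('x \<Rightarrow> complex)" where
  "proj_off V r f = (if f \<in> ell2 V then (\<lambda>x. if x = r then 0 else f x) else (\<lambda>x. 0))"

lemma proj_off_eq:
  assumes "f \<in> ell2 V"
  shows "proj_off V r f = (\<lambda>x. f x + (- f r) * delta r x)"
  using assms by (auto simp: proj_off_def delta_def)

lemma proj_off_bounded: "proj_off V r \<in> bounded_ops V"
proof (rule bounded_opsI[where C = 1])
  fix f assume f: "f \<in> ell2 V"
  have "(\<Sum>x\<in>F. (cmod (proj_off V r f x))\<^sup>2) \<le> 1 * norm_sq V f" if "finite F" "F \<subseteq> V" for F
  proof -
    have "(\<Sum>x\<in>F. (cmod (proj_off V r f x))\<^sup>2) \<le> (\<Sum>x\<in>F. (cmod (f x))\<^sup>2)"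
      using f by (intro sum_mono) (auto simp: proj_off_def)
    also have "\<dots> \<le> norm_sq V f"
      by (rule sum_le_norm_sq[OF f that])
    finally show ?thesis
      by simp
  qed
  moreover have "proj_off V r f x = 0" if "x \<notin> V" for x
    using f that by (auto simp: proj_off_def ell2_def)
  ultimately show "proj_off V r f \<in> ell2 V" "norm_sq V (proj_off V r f) \<le> 1 * norm_sq V f"
    using ell2I_finite_sums[of V "proj_off V r f" "1 * norm_sq V f"] by blast+
  fix g assume "g \<in> ell2 V"
  with f show "proj_off V r (\<lambda>x. f x + g x) = (\<lambda>x. proj_off V r f x + proj_off V r g x)"
    by (auto simp: proj_off_def ell2_add(1))
next
  fix f c assume "f \<in> ell2 V"
  then show "proj_off V r (\<lambda>x. c * f x) = (\<lambda>x. c * proj_off V r f x)"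
    by (auto simp: proj_off_def ell2_mult)
qed (simp add: proj_off_def)

text \<open>The complement of \<open>proj_off\<close> is the rank one projection onto the delta
  function of \<open>r\<close>; inserted between \<open>T1\<close> and \<open>T2\<close> it
  factorizes the state.\<close>

lemma vector_state_proj_off:
  assumes r: "r \<in> V" and T: "T1 \<in> bounded_ops V" "T2 \<in> bounded_ops V"
  shows "vector_state V (delta r) (T1 \<circ> proj_off V r \<circ> T2) =
    vector_state V (delta r) (T1 \<circ> T2) - vector_state V (delta r) T1 * vector_state V (delta r) T2"
proof -
  let ?g = "T2 (delta r)"
  note d = delta_in_ell2[OF r]
  have g: "?g \<in> ell2 V"
    by (rule bounded_opsD(2)[OF T(2) d])
  have "T1 (proj_off V r ?g) = (\<lambda>x. T1 ?g x + T1 (\<lambda>x. (- ?g r) * delta r x) x)"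
    unfolding proj_off_eq[OF g] by (rule bounded_opsD(4)[OF T(1) g ell2_mult[OF d]])
  also have "\<dots> = (\<lambda>x. T1 ?g x + (- ?g r) * T1 (delta r) x)"
    by (simp only: bounded_opsD(5)[OF T(1) d])
  finally show ?thesis
    by (simp add: vector_state_delta[OF r])
qed

lemma list_product_Cons: "list_product (op_algebra V) (a # as) f = a (list_product (op_algebra V) as f)"
  by (simp add: list_product_def op_algebra_simps)

section \<open>The two algebras as operators acting on copies\<close>

context rooted_graph_pair
begin

definition copies1 where
  "copies1 = acts_on_copies (verts P) {w. word w \<and> even (length w)} (glue e1 Inl)"

text \<open>The vanishing at the root reflects the subtracted unit: by the loop, \<open>R2 f\<close>
  and \<open>f\<close> agree at the root. This algebra and \<open>copies1\<close> contain the
  generated ones and replace reasoning about hulls.\<close>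

definition copies2 where
  "copies2 = acts_on_copies (verts P) {w. word w \<and> odd (length w)} (glue e2 Inr) \<inter>
    {T \<in> bounded_ops (verts P). \<forall>f\<in>ell2 (verts P). T f [] = 0}"

lemma subalg_copies1: "subalg M copies1"
  unfolding copies1_def by (rule subalg_acts_on_copies)

lemma subalg_copies2: "subalg M copies2"
proof -
  have "subalg M (\<Inter>{acts_on_copies (verts P) {w. word w \<and> odd (length w)} (glue e2 Inr),
      {T \<in> bounded_ops (verts P). \<forall>f\<in>ell2 (verts P). T f [] = 0}})"
    by (rule subalg_Inter) (auto intro: subalg_acts_on_copies subalg_vanishing_at)
  then show ?thesis
    by (simp add: copies2_def)
qed

lemma one_copies1: "\<one>\<^bsub>M\<^esub> \<in> copies1"
  unfolding copies1_def by (rule acts_on_copies_one)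

lemma R1_copies: "R1 \<ominus>\<^bsub>M\<^esub> \<one>\<^bsub>M\<^esub> \<in> copies1"
proof -
  have "R1 \<in> copies1"
    unfolding copies1_def
  proof (rule acts_on_copiesI[OF R1_bounded homogeneous_nbr_sum])
    fix f :: "('a + 'b) list \<Rightarrow> complex" and w
    assume "f \<in> ell2 (verts P)" and "w \<in> {w. word w \<and> even (length w)}"
    then show "(\<lambda>v. R1 f (glue e1 Inl w v)) =
        (\<lambda>v. if v \<in> verts G1 then nbr_sum G1 (\<lambda>v. f (glue e1 Inl w v)) v else 0)"
      by (auto simp: R1_eq word_glue1 nbr_sum_C1)
  qed
  then show ?thesis
    by (rule subalg_minus[OF subalg_copies1 _ one_copies1])
qed

lemma R2_copies: "R2 \<ominus>\<^bsub>M\<^esub> \<one>\<^bsub>M\<^esub> \<in> copies2"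
proof -
  have "R2 \<in> acts_on_copies (verts P) {w. word w \<and> odd (length w)} (glue e2 Inr)"
  proof (rule acts_on_copiesI[OF R2_bounded homogeneous_nbr_sum])
    fix f :: "('a + 'b) list \<Rightarrow> complex" and w
    assume "f \<in> ell2 (verts P)" and "w \<in> {w. word w \<and> odd (length w)}"
    then show "(\<lambda>v. R2 f (glue e2 Inr w v)) =
        (\<lambda>v. if v \<in> verts G2 then nbr_sum G2 (\<lambda>v. f (glue e2 Inr w v)) v else 0)"
      by (auto simp: R2_eq word_glue2 nbr_sum_C2)
  qed
  then have "R2 \<ominus>\<^bsub>M\<^esub> \<one>\<^bsub>M\<^esub> \<in> acts_on_copies (verts P) {w. word w \<and> odd (length w)} (glue e2 Inr)"
    by (rule subalg_minus[OF subalg_acts_on_copies]) (rule acts_on_copies_one)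
  moreover have "(R2 \<ominus>\<^bsub>M\<^esub> \<one>\<^bsub>M\<^esub>) f [] = 0" if "f \<in> ell2 (verts P)" for f
    using that bounded_ops_one[of "verts P"]
    by (simp add: op_algebra_simps(3) op_algebra_minus R2_eq nbr_sum_C2_root)
  ultimately show ?thesis
    by (auto simp: copies2_def acts_on_copies_def)
qed

abbreviation u where "u \<equiv> proj_off (verts P) []"

lemma u_copies: "u \<in> copies2"
proof -
  have "u \<in> acts_on_copies (verts P) {w. word w \<and> odd (length w)} (glue e2 Inr)"
    by (rule acts_on_copiesI[where t = "\<lambda>f. f"])
      (auto simp: proj_off_bounded homogeneous_def proj_off_def glue_nonempty)
  then show ?thesis
    by (simp add: copies2_def proj_off_bounded) (simp add: proj_off_def)
qed

abbreviation A1 where "A1 \<equiv> alg M {\<one>\<^bsub>M\<^esub>, R1 \<ominus>\<^bsub>M\<^esub> \<one>\<^bsub>M\<^esub>}"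
abbreviation A2 where "A2 \<equiv> alg M {u, R2 \<ominus>\<^bsub>M\<^esub> \<one>\<^bsub>M\<^esub>}"

lemma A1_copies: "A1 \<subseteq> copies1"
  using R1_copies one_copies1 by (intro alg_minimal subalg_copies1) simp

lemma A2_copies: "A2 \<subseteq> copies2"
  using R2_copies u_copies by (intro alg_minimal subalg_copies2) simp

text \<open>On a copy of the second graph, \<open>T f\<close> depends only on the restriction of
  \<open>f\<close> to it, which \<open>u\<close> leaves unchanged because the copy avoids the root;
  at the root itself \<open>T f\<close> is 0.\<close>

lemma u_unit:
  assumes "T \<in> copies2"
  shows "u \<circ> T = T" and "T \<circ> u = T"
proof -
  have T: "T \<in> bounded_ops (verts P)" and root: "\<And>f. f \<in> ell2 (verts P) \<Longrightarrow> T f [] = 0"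
    and copies: "T \<in> acts_on_copies (verts P) {w. word w \<and> odd (length w)} (glue e2 Inr)"
    using assms by (auto simp: copies2_def)
  have "T f [] = 0" for f
    using root[of f] bounded_opsD(1)[OF T, of f] by (cases "f \<in> ell2 (verts P)") simp_all
  then show "u \<circ> T = T"
    using bounded_opsD(3)[OF T] by (auto simp: fun_eq_iff proj_off_def)
  obtain t where t: "\<And>f w. f \<in> ell2 (verts P) \<Longrightarrow> word w \<and> odd (length w) \<Longrightarrow>
      (\<lambda>v. T f (glue e2 Inr w v)) = t (\<lambda>v. f (glue e2 Inr w v))"
    by (rule acts_on_copiesE[OF copies]) blast
  have "T (u f) x = T f x" for f x
  proof (cases "f \<in> ell2 (verts P)")
    case True
    note uf = bounded_opsD(2)[OF proj_off_bounded this]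
    show ?thesis
    proof (cases "word x \<and> x \<noteq> []")
      case True
      then obtain w v where w: "odd (length w)" "word w" "x = glue e2 Inr w v"
        using word_cases2 by metis
      have "(\<lambda>v. T (u f) (glue e2 Inr w v)) = (\<lambda>v. T f (glue e2 Inr w v))"
        unfolding t[OF uf conjI[OF w(2,1)]] t[OF \<open>f \<in> ell2 (verts P)\<close> conjI[OF w(2,1)]]
        using w(1) \<open>f \<in> ell2 (verts P)\<close> by (simp add: proj_off_def glue_nonempty)
      then show ?thesis
        using w(3) by (simp add: fun_eq_iff)
    next
      case False
      then consider "x = []" | "x \<notin> verts P"
        by (auto simp: verts_P)
      then show ?thesis
        using root[OF True] root[OF uf] bounded_opsD(3)[OF T, of f] bounded_opsD(3)[OF T, of "u f"]
        by cases (auto simp: ell2_def)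
    qed
  next
    case False
    have "T (\<lambda>x. 0) = (\<lambda>x. 0)"
      using bounded_opsD(5)[OF T ell2_zero, of 0] by simp
    with False show ?thesis
      using bounded_opsD(1)[OF T False] by (simp add: proj_off_def)
  qed
  then show "T \<circ> u = T"
    by (simp add: fun_eq_iff)
qed

text \<open>On a copy, a vector supported on the root of the copy is a multiple of the delta function there,
  whose image under a centered operator vanishes at the root.\<close>

lemma centered_copies1:
  assumes T: "T \<in> copies1" and \<phi>: "\<phi> T = 0" and f: "f \<in> ell2 (verts P)"
    and odd: "\<And>x. odd (length x) \<Longrightarrow> f x = 0" and x: "even (length x)"
  shows "T f x = 0"
proof -
  obtain t where t: "T \<in> bounded_ops (verts P)" "homogeneous t"
    "\<And>f w. f \<in> ell2 (verts P) \<Longrightarrow> w \<in> {w. word w \<and> even (length w)} \<Longrightarrow>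
      (\<lambda>v. T f (glue e1 Inl w v)) = t (\<lambda>v. f (glue e1 Inl w v))"
    using T unfolding copies1_def by (rule acts_on_copiesE) blast
  \<comment> \<open>The copy at an even word \<open>w\<close> has all its other vertices at odd
    words, so \<open>f\<close> restricts to \<open>f w\<close> times the delta function of
    \<open>e1\<close>.\<close>
  have *: "T f w = f w * t (delta e1) e1"
    if "f \<in> ell2 (verts P)" "\<And>x. odd (length x) \<Longrightarrow> f x = 0" "word w" "even (length w)" for f w
  proof -
    have "(\<lambda>v. f (glue e1 Inl w v)) = (\<lambda>v. if v = e1 then f w else 0)"
      using that by (auto simp: glue_def)
    then show ?thesis
      using fun_cong[OF t(3)[OF that(1)], of w e1] that(3,4) homogeneous_delta[OF t(2)]
      by (simp add: glue_def)
  qed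
  have "delta [] y = 0" if "odd (length y)" for y :: "('a + 'b) list"
    using that by (auto simp: delta_def)
  moreover have "delta [] ([] :: ('a + 'b) list) = 1"
    by (simp add: delta_def)
  \<comment> \<open>Testing on the delta function of the root identifies the local constant.\<close>
  ultimately have "t (delta e1) e1 = \<phi> T"
    using *[OF delta_in_ell2[OF root_in_verts_P], of "[]"]
    by (simp add: vector_state_delta[OF root_in_verts_P])
  then show ?thesis
    using *[OF f odd] x \<phi> bounded_opsD(3)[OF t(1), of f] by (cases "word x") (auto simp: ell2_def verts_P)
qed

text \<open>The scalar \<open>c\<close> is the same for all \<open>f\<close>, which is why every
  admissible unit vector gives the same state on the second algebra.\<close>

lemma copies2_odd:
  assumes "T \<in> copies2"
  obtains c where "\<And>f x. f \<in> ell2 (verts P) \<Longrightarrow> (\<And>y. even (length y) \<Longrightarrow> f y = 0) \<Longrightarrow> odd (length x) \<Longrightarrow> T f x = f x * c"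
proof -
  have T: "T \<in> bounded_ops (verts P)"
    and copies: "T \<in> acts_on_copies (verts P) {w. word w \<and> odd (length w)} (glue e2 Inr)"
    using assms by (auto simp: copies2_def)
  obtain t where t: "homogeneous t"
    "\<And>f w. f \<in> ell2 (verts P) \<Longrightarrow> w \<in> {w. word w \<and> odd (length w)} \<Longrightarrow>
      (\<lambda>v. T f (glue e2 Inr w v)) = t (\<lambda>v. f (glue e2 Inr w v))"
    by (rule acts_on_copiesE[OF copies]) blast
  have "T f x = f x * t (delta e2) e2"
    if f: "f \<in> ell2 (verts P)" and even: "\<And>y. even (length y) \<Longrightarrow> f y = 0" and x: "odd (length x)" for f x
  proof (cases "word x")
    case True
    have "(\<lambda>v. f (glue e2 Inr x v)) = (\<lambda>v. if v = e2 then f x else 0)"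
      using even x by (auto simp: glue_def)
    then show ?thesis
      using fun_cong[OF t(2)[OF f], of x e2] True x homogeneous_delta[OF t(1)] by (simp add: glue_def)
  next
    case False
    then show ?thesis
      using f bounded_opsD(3)[OF T, of f] by (auto simp: ell2_def verts_P)
  qed
  then show ?thesis
    using that by blast
qed

lemma copies2_kills_delta:
  assumes "T \<in> copies2"
  shows "T (delta []) = (\<lambda>x. 0)"
proof -
  note d = delta_in_ell2[OF root_in_verts_P]
  have "u (delta []) = (\<lambda>x. 0)"
    using d by (auto simp: proj_off_def delta_def)
  moreover have "T (\<lambda>x. 0) = (\<lambda>x. 0)"
    using assms bounded_opsD(5)[OF _ ell2_zero, of T "verts P" 0] by (simp add: copies2_def)
  ultimately show ?thesis
    using u_unit(2)[OF assms] by (metis comp_apply)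
qed

section \<open>The second state and alternating products\<close>

context
  fixes \<zeta> :: "('a + 'b) list \<Rightarrow> complex"
  assumes \<zeta>: "\<zeta> \<in> ell2 (glue e1 Inl [] ` (verts G1 - {e1}))" and \<zeta>_norm: "ell2_norm (verts P) \<zeta> = 1"
begin

abbreviation \<psi> where "\<psi> \<equiv> vector_state (verts P) \<zeta>"

lemma \<zeta>_ell2: "\<zeta> \<in> ell2 (verts P)"
  by (rule ell2_mono[OF _ \<zeta>]) (auto simp: verts_P glue_def)

lemma \<zeta>_even: "even (length x) \<Longrightarrow> \<zeta> x = 0"
proof -
  assume "even (length x)"
  then have "x \<notin> glue e1 Inl [] ` (verts G1 - {e1})"
    by (auto simp: glue_def)
  then show ?thesis
    using \<zeta> by (simp add: ell2_def)
qed

text \<open>Even coordinates drop out of the inner product because \<open>\<zeta>\<close> vanishes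
  there; on the others \<open>T\<close> multiplies by \<open>c\<close>, and \<open>\<zeta>\<close>
  has norm 1.\<close>

lemma \<psi>_eq:
  assumes "\<And>x. odd (length x) \<Longrightarrow> T \<zeta> x = \<zeta> x * c"
  shows "\<psi> T = c"
proof -
  have "T \<zeta> x * cnj (\<zeta> x) = c * (\<zeta> x * cnj (\<zeta> x))" for x
    using assms[of x] \<zeta>_even[of x] by (cases "even (length x)") simp_all
  then have "T \<zeta> x * cnj (\<zeta> x) = c * complex_of_real ((cmod (\<zeta> x))\<^sup>2)" for x
    by (simp only: complex_norm_square)
  moreover have "(\<Sum>\<^sub>\<infinity>x\<in>verts P. complex_of_real ((cmod (\<zeta> x))\<^sup>2)) = complex_of_real (norm_sq (verts P) \<zeta>)"
    unfolding norm_sq_def using \<zeta>_ell2 by (intro infsumI has_sum_of_real) (simp add: ell2_def)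
  ultimately have "\<psi> T = c * complex_of_real (norm_sq (verts P) \<zeta>)"
    by (simp only: vector_state_def ell2_inner_def infsum_cmult_right')
  moreover have "norm_sq (verts P) \<zeta> = 1"
    using \<zeta>_norm by (simp add: ell2_norm_eq)
  ultimately show ?thesis
    by simp
qed

lemma centered_copies2:
  assumes T: "T \<in> copies2" and "\<psi> T = 0" and "f \<in> ell2 (verts P)"
    and "\<And>x. even (length x) \<Longrightarrow> f x = 0" and "odd (length x)"
  shows "T f x = 0"
proof -
  obtain c where c: "\<And>f x. f \<in> ell2 (verts P) \<Longrightarrow> (\<And>y. even (length y) \<Longrightarrow> f y = 0) \<Longrightarrow>
      odd (length x) \<Longrightarrow> T f x = f x * c"
    by (rule copies2_odd[OF T]) blast
  have "\<psi> T = c"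
    by (rule \<psi>_eq) (rule c[OF \<zeta>_ell2 \<zeta>_even])
  then show ?thesis
    using c[of f x] assms by simp
qed

text \<open>The head of the list acts last. After a factor from \<open>A1\<close> the support lies
  on odd words, after one from \<open>A2\<close> on even words; the empty word is even, hence the
  separate clause for it. The start is the delta function of the root, which has even support and is
  killed by the second algebra.\<close>

lemma centered_product:
  assumes "list_all2 (\<lambda>i a. i = (1::nat) \<and> a \<in> A1 \<and> \<phi> a = 0 \<or> i = 2 \<and> a \<in> A2 \<and> \<psi> a = 0) is as"
    and "successively (\<noteq>) is"
  shows "list_product M as (delta []) \<in> ell2 (verts P) \<and>
    (is \<noteq> [] \<and> hd is = 1 \<longrightarrow> (\<forall>x. even (length x) \<longrightarrow> list_product M as (delta []) x = 0)) \<and>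
    (is \<noteq> [] \<and> hd is = 2 \<longrightarrow> list_product M as (delta []) [] = 0 \<and>
      (\<forall>x. odd (length x) \<longrightarrow> list_product M as (delta []) x = 0)) \<and>
    (is = [] \<longrightarrow> list_product M as (delta []) = delta [])"
  using assms
proof (induction rule: list_all2_induct)
  case Nil
  show ?case
    by (simp add: list_product_def op_algebra_simps delta_in_ell2 root_in_verts_P)
next
  case (Cons i "is" a as)
  let ?f = "list_product M as (delta [])"
  have "successively (\<noteq>) is"
    using Cons.prems by (cases "is") auto
  note IH = Cons.IH[OF this]
  have f: "?f \<in> ell2 (verts P)"
    using IH by blast
  from Cons.hyps(1) show ?case
  proof
    assume a: "i = 1 \<and> a \<in> A1 \<and> \<phi> a = 0"
    then have c: "a \<in> copies1"
      using A1_copies by blast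
    have "?f x = 0" if "odd (length x)" for x
    proof (cases "is")
      case Nil
      then have "?f = delta []"
        using IH by blast
      then show ?thesis
        using that by (auto simp: delta_def)
    next
      case (Cons j js)
      then have "j = 2"
        using Cons.prems Cons.hyps a \<open>list_all2 _ is as\<close> by (auto simp: list_all2_Cons1)
      then show ?thesis
        using IH that Cons by simp
    qed
    then have "a ?f x = 0" if "even (length x)" for x
      using centered_copies1[OF c _ f _ that] a by blast
    moreover have "a ?f \<in> ell2 (verts P)"
      using c f by (auto simp: copies1_def acts_on_copies_def bounded_opsD(2))
    ultimately show ?case
      using a by (simp add: list_product_Cons)
  next
    assume a: "i = 2 \<and> a \<in> A2 \<and> \<psi> a = 0"
    then have c: "a \<in> copies2"
      using A2_copies by blast
    have "a ?f x = 0" if "odd (length x)" for x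
    proof (cases "is")
      case Nil
      then have "?f = delta []"
        using IH by blast
      then show ?thesis
        by (simp add: copies2_kills_delta[OF c])
    next
      case (Cons j js)
      then have "j = 1"
        using Cons.prems a \<open>list_all2 _ is as\<close> by (auto simp: list_all2_Cons1)
      then have "?f x = 0" if "even (length x)" for x
        using IH that Cons by simp
      then show ?thesis
        using centered_copies2[OF c _ f _ that] a by blast
    qed
    moreover have "a ?f \<in> ell2 (verts P)" "a ?f [] = 0"
      using c f by (auto simp: copies2_def bounded_opsD(2))
    ultimately show ?case
      using a by (simp add: list_product_Cons)
  qed
qed

lemma s_free_A1_A2: "s_free M \<phi> \<psi> A1 A2 u"
  unfolding s_free_def
proof (intro conjI allI impI ballI)
  have "{\<one>\<^bsub>M\<^esub>, R1 \<ominus>\<^bsub>M\<^esub> \<one>\<^bsub>M\<^esub>} \<subseteq> bounded_ops (verts P)"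
    using bounded_ops_minus[OF R1_bounded bounded_ops_one] bounded_ops_one by (simp add: op_algebra_simps(3))
  then show A1: "subalg M A1"
    by (rule subalg_alg)
  have "{u, R2 \<ominus>\<^bsub>M\<^esub> \<one>\<^bsub>M\<^esub>} \<subseteq> bounded_ops (verts P)"
    using bounded_ops_minus[OF R2_bounded bounded_ops_one] proj_off_bounded by (simp add: op_algebra_simps(3))
  then show A2: "subalg M A2"
    by (rule subalg_alg)
  show "\<one>\<^bsub>M\<^esub> \<in> A1" "u \<in> A2"
    by (rule subset_alg[THEN subsetD], simp)+
  show "u \<otimes>\<^bsub>M\<^esub> b = b" "b \<otimes>\<^bsub>M\<^esub> u = b" if "b \<in> A2" for b
    using u_unit[of b] A2_copies that by (auto simp: op_algebra_simps)
  show "\<psi> u = 1"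
    by (rule \<psi>_eq) (auto simp: proj_off_def \<zeta>_ell2)
  show "\<phi> (list_product M as) = 0"
    if "as \<noteq> [] \<and> successively (\<noteq>) is \<and>
      list_all2 (\<lambda>i a. i = (1::nat) \<and> a \<in> A1 \<and> \<phi> a = 0 \<or> i = 2 \<and> a \<in> A2 \<and> \<psi> a = 0) is as" for "is" as
  proof -
    have "is \<noteq> []" "hd is = 1 \<or> hd is = 2"
      using that by (auto simp: list_all2_Cons2 neq_Nil_conv)
    then show ?thesis
      using centered_product[of "is" as] that by (auto simp: vector_state_delta[OF root_in_verts_P])
  qed
  have "alg M (A1 \<union> A2) \<subseteq> bounded_ops (verts P)"
    using A1 A2 by (intro alg_minimal subalg_bounded_ops) (auto simp: subalg_def op_algebra_simps)
  then show "\<phi> (w1 \<otimes>\<^bsub>M\<^esub> u \<otimes>\<^bsub>M\<^esub> w2) = \<phi> (w1 \<otimes>\<^bsub>M\<^esub> w2) - \<phi> w1 * \<phi> w2"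
    if "w1 \<in> alg M (A1 \<union> A2)" "w2 \<in> alg M (A1 \<union> A2)" for w1 w2
    using that vector_state_proj_off[OF root_in_verts_P, of w1 w2] by (auto simp: op_algebra_simps(2))
qed

lemma s_free_pair_R1_R2: "s_free_pair M \<phi> \<psi> (R1 \<ominus>\<^bsub>M\<^esub> \<one>\<^bsub>M\<^esub>) (R2 \<ominus>\<^bsub>M\<^esub> \<one>\<^bsub>M\<^esub>)"
  unfolding s_free_pair_def op_algebra_simps(1) by (intro bexI[where x = u] s_free_A1_A2 proj_off_bounded)

end

end

theorem theorem9p1:
  fixes G1 :: "('a, 'c) mgraph" and e1 :: 'a
    and G2 :: "('b, 'd) mgraph" and e2 :: 'b
    and \<mu>1 \<mu>2 :: "complex poly \<Rightarrow> complex"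
    and P :: "(('a + 'b) list, (('a + 'b) list \<times> ('c + 'd)) option) cgraph"
    and e :: "('a + 'b) list"
    and M :: "(complex, (('a + 'b) list \<Rightarrow> complex) \<Rightarrow> (('a + 'b) list \<Rightarrow> complex)) module"
    and \<phi> :: "((('a + 'b) list \<Rightarrow> complex) \<Rightarrow> (('a + 'b) list \<Rightarrow> complex)) \<Rightarrow> complex"
    and R1 R2 Z :: "(('a + 'b) list \<Rightarrow> complex) \<Rightarrow> (('a + 'b) list \<Rightarrow> complex)"
  assumes "rooted_graph G1 e1" and "rooted_graph G2 e2"
    and "\<mu>1 = spectral_distribution G1 e1" and "\<mu>2 = spectral_distribution G2 e2"
    and "P = sfree_loop_product G1 e1 G2 e2" and "e = []"
    and "M = op_algebra (verts P)" and "\<phi> = vector_state (verts P) (delta e)"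
    and "R1 = adjacency_op (color_subgraph P 1)" and "R2 = adjacency_op (color_subgraph P 2)"
    and "Z = R2 \<otimes>\<^bsub>M\<^esub> R1"
  shows "adjacency_op P = R1 \<oplus>\<^bsub>M\<^esub> R2 \<and>
    (\<forall>n\<ge>1. N_coeff (distribution M \<phi> Z) n = N_coeff (sfree_conv \<mu>1 \<mu>2) n \<and>
       finite (D_walks P (2 * n) e) \<and>
       N_coeff (sfree_conv \<mu>1 \<mu>2) n = of_nat (card (D_walks P (2 * n) e))) \<and>
    (\<forall>\<zeta>. \<zeta> \<in> ell2 (glue e1 Inl [] ` (verts G1 - {e1})) \<and> ell2_norm (verts P) \<zeta> = 1 \<longrightarrow>
       s_free_pair M \<phi> (vector_state (verts P) \<zeta>) (R1 \<ominus>\<^bsub>M\<^esub> \<one>\<^bsub>M\<^esub>) (R2 \<ominus>\<^bsub>M\<^esub> \<one>\<^bsub>M\<^esub>))"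
proof -
  interpret pair: rooted_graph_pair G1 e1 G2 e2
    by unfold_locales (rule assms)+
  note eqs = assms(3-) pair.C1_def[symmetric] pair.C2_def[symmetric]
  have "adjacency_op P = R1 \<oplus>\<^bsub>M\<^esub> R2"
    unfolding eqs by (rule pair.adjacency_op_P)
  moreover have "N_coeff (distribution M \<phi> Z) n = N_coeff (sfree_conv \<mu>1 \<mu>2) n \<and>
      finite (D_walks P (2 * n) e) \<and>
      N_coeff (sfree_conv \<mu>1 \<mu>2) n = of_nat (card (D_walks P (2 * n) e))" if "n \<ge> 1" for n
    unfolding eqs N_coeff_def pair.eta_series_Z eta_series_sfree_conv
    using pair.card_D_walks[OF that] by simp
  moreover have "s_free_pair M \<phi> (vector_state (verts P) \<zeta>) (R1 \<ominus>\<^bsub>M\<^esub> \<one>\<^bsub>M\<^esub>) (R2 \<ominus>\<^bsub>M\<^esub> \<one>\<^bsub>M\<^esub>)"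
    if "\<zeta> \<in> ell2 (glue e1 Inl [] ` (verts G1 - {e1}))" "ell2_norm (verts P) \<zeta> = 1" for \<zeta>
    using pair.s_free_pair_R1_R2[of \<zeta>] that unfolding eqs by blast
  ultimately show ?thesis
    by blast
qed

end
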